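(* Consider the polling model with rotational symmetry described in the context, with $\mathcal L$ ergodic. Assume that $\tilde\mu_k\neq1$ for every $1\le k<N$ and that $$[I-P][I-{}^*\widetilde P]=[I-{}^*P][I-\widetilde P],$$ where ${}^*M$ denotes the transpose of $M$. Then, for any station $m\in\mathcal S$, in the stationary regime: (i) the probability that the server finds station $m$ empty is $$\mathbb P(X_m=0\mid S=m)=\frac{1-N\alpha}{1-N\alpha+N\tilde\alpha};$$ (ii) the mean number of customers found by the server when it arrives at station $m$ is $$\begin{aligned}\mathbb E[X_m\mid S=m]={}& N\bar\alpha+\frac{N\tilde\alpha\bar\alpha}{1-N\alpha}\sum_{l=1}^{N-1}\frac1{1-\tilde\mu_l}+\frac{1-N\alpha+N\tilde\alpha}{1-N\alpha}\,\frac N2\,\bar\alpha^{(2)}_N+\frac{N\alpha-N\tilde\alpha}{1-N\alpha}\,\frac12\sum_{d=1}^N\bar\alpha^{(2)}_d\\&-\frac{N\tilde\alpha}{1-N\alpha}\sum_{l=1}^{N-1}\frac{\mu_l-\tilde\mu_l}{1-\tilde\mu_l}\,\frac12\sum_{d=1}^N\bar\alpha^{(2)}_d\omega_l^d;\end{aligned}$$ (iii) the mean number of customers present at station $m$ at a polling instant is $$\begin{aligned}\mathbb E X_m={}&\bar\alpha+\frac{\tilde\alpha}{1-N\alpha}\sum_{l=1}^{N-1}\frac1{1-\tilde\mu_l}+\frac{1-N\alpha+N\tilde\alpha}{1-N\alpha}\,\frac N2\,\bar\alpha^{(2)}_N+\frac{N\alpha-N\tilde\alpha}{1-N\alpha}\,\frac12\sum_{d=1}^N\bar\alpha^{(2)}_d\\&-\frac{1-N\alpha+N\tilde\alpha}{1-N\alpha}\sum_{l=1}^{N-1}\frac{\mu_l-\tilde\mu_l}{1-\tilde\mu_l}\,\frac12\sum_{d=1}^N\bar\alpha^{(2)}_d\omega_l^d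 .\end{aligned}$$
   Context: Polling model. Let $\mathcal S=\{1,\ldots,N\}$ be the set of stations and let $P=(p_{i,j})_{i,j\in\mathcal S}$ and $\widetilde P=(\tilde p_{i,j})_{i,j\in\mathcal S}$ be stochastic matrices. For each $i,j$, $(B_{i,j}(n))_n$ and $(\widetilde B_{i,j}(n))_n$ are sequences of random vectors in $\mathbb Z_+^N$, i.i.d. in $n$; the components of each vector may be dependent. The process $\mathcal L=(S(n),X(n))_{n\ge 0}$, with $S(n)\in\mathcal S$ (position of the server at polling instant $n$) and $X(n)\in\mathbb Z_+^N$ (queue lengths at polling instant $n$), is the Markov chain with the following dynamics. Given the past up to $n$ with $S(n)=i$: - if $X_i(n)>0$, then $S(n+1)=j$ with probability $p_{i,j}$, and in that case $X(n+1)=X(n)-\vec e_i+B_{i,j}(n)$; - if $X_i(n)=0$, then $S(n+1)=j$ with probability $\tilde p_{i,j}$, and in that case $X(n+1)=X(n)+\widetilde B_{i,j}(n)$. Here $\vec e_i$ is the $i$-th canonical basis vector, and the routing choices and the vectors $B_{i,j}(n),\widetilde B_{i,j}(n)$ are independent of each other and of the past up to $n$. The chain $\mathcal L$ is assumed irreducible and ergodic; $(S,X)$ denotes a pair with its stationary distribution. All random variables of interest (the arrival vectors and the stationary queue lengths) are assumed to have finite second moments. Generating functions: $a_{i,j}(\vec z)=\mathbb E[z_1^{B_{i,j;1}(n)}\cdots z_N^{B_{i,j;N}(n)}]$ and $\tilde a_{i,j}(\vec z)=\mathbb E[z_1^{\widetilde B_{i,j;1}(n)}\cdots z_N^{\widetilde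 B_{i,j;N}(n)}]$. Rotational symmetry (all station indices are taken modulo $N$ in $\{1,\ldots,N\}$): for all $i,j$, $p_{i,j}=p_{j-i}$, $\tilde p_{i,j}=\tilde p_{j-i}$, $a_{i,j}(\vec z)=a_{j-i}(\vec z)$ and $\tilde a_{i,j}(\vec z)=\tilde a_{j-i}(\vec z)$; and for all $1\le s,d\le N$, $a_d(z_1,\ldots,z_N)=a_d(z_{1+s},\ldots,z_{N+s})$ and $\tilde a_d(z_1,\ldots,z_N)=\tilde a_d(z_{1+s},\ldots,z_{N+s})$. Notation. $\omega_k=\exp(2\pi \mathrm i k/N)$ with $\mathrm i^2=-1$; $\vec e=(1,\ldots,1)$; $\mu_k(\vec z)=\sum_{d=1}^Np_da_d(\vec z)\omega_k^d$, $\tilde\mu_k(\vec z)=\sum_{d=1}^N\tilde p_d\tilde a_d(\vec z)\omega_k^d$; $\mu_k=\mu_k(\vec e)$, $\tilde\mu_k=\tilde\mu_k(\vec e)$. Further, $\alpha=\frac{\partial\mu_N}{\partial z_m}(\vec e)$ and $\tilde\alpha=\frac{\partial\tilde\mu_N}{\partial z_m}(\vec e)$ (independent of $m$); $\alpha_d^{(2)}=\frac{\partial^2\mu_N}{\partial z_q\partial z_{q+d}}(\vec e)$ and $\tilde\alpha_d^{(2)}=\frac{\partial^2\tilde\mu_N}{\partial z_q\partial z_{q+d}}(\vec e)$ for $1\le d\le N$ (independent of $q$; $d=N$ gives $\partial^2/\partial z_q^2$). Finally $$\bar\alpha=\mathbb P(X_m>0\mid S=m)\,\alpha+\mathbb P(X_m=0\mid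 S=m)\,\tilde\alpha,\qquad \bar\alpha^{(2)}_d=\mathbb P(X_m>0\mid S=m)\,\alpha^{(2)}_d+\mathbb P(X_m=0\mid S=m)\,\tilde\alpha^{(2)}_d .$$ *)

theory Defs
  imports "HOL-Probability.Probability" "Jordan_Normal_Form.Matrix"
begin

text \<open>Stations are the numbers \<open>1, \<dots>, N\<close>; \<open>stn N k\<close> is the representative of \<open>k\<close>
  modulo \<open>N\<close> in that range (so a multiple of \<open>N\<close> is sent to \<open>N\<close>, not to \<open>0\<close>).\<close>

definition stn :: "nat \<Rightarrow> int \<Rightarrow> nat" where
  "stn N k = nat ((k - 1) mod int N) + 1"

text \<open>A vector of \<open>N\<close> natural numbers is a function on \<open>nat\<close> that vanishes off \<open>{1..N}\<close>.\<close>

definition queue_space :: "nat \<Rightarrow> (nat \<Rightarrow> nat) set" where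
  "queue_space N = {x. \<forall>k. k \<notin> {1..N} \<longrightarrow> x k = 0}"

type_synonym state = "nat \<times> (nat \<Rightarrow> nat)"

definition state_space :: "nat \<Rightarrow> state set" where
  "state_space N = {1..N} \<times> queue_space N"

definition stochastic :: "nat \<Rightarrow> (nat \<Rightarrow> nat \<Rightarrow> real) \<Rightarrow> bool" where
  "stochastic N P \<longleftrightarrow>
     (\<forall>i\<in>{1..N}. (\<forall>j\<in>{1..N}. 0 \<le> P i j) \<and> (\<Sum>j=1..N. P i j) = 1)"

definition station_mat :: "nat \<Rightarrow> (nat \<Rightarrow> nat \<Rightarrow> real) \<Rightarrow> real mat" where
  "station_mat N P = Matrix.mat N N (\<lambda>(i, j). P (Suc i) (Suc j))"

text \<open>\<open>B i j\<close> is the common law of the i.i.d. arrival vectors \<open>B\<^bsub>i,j\<^esub>(n)\<close>.\<close>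

definition arrival_laws :: "nat \<Rightarrow> (nat \<Rightarrow> nat \<Rightarrow> (nat \<Rightarrow> nat) pmf) \<Rightarrow> bool" where
  "arrival_laws N B \<longleftrightarrow>
     (\<forall>i\<in>{1..N}. \<forall>j\<in>{1..N}. set_pmf (B i j) \<subseteq> queue_space N \<and>
        (\<forall>k\<in>{1..N}. integrable (measure_pmf (B i j)) (\<lambda>b. (real (b k))\<^sup>2)))"

definition route :: "nat \<Rightarrow> (nat \<Rightarrow> nat \<Rightarrow> real) \<Rightarrow> nat \<Rightarrow> nat pmf" where
  "route N P i = embed_pmf (\<lambda>j. if j \<in> {1..N} then P i j else 0)"

text \<open>The transition law of the chain \<open>(S(n), X(n))\<close>: the next station is drawn first, then an
  arrival vector, both independently of the past. Primed parameters are the tilde quantities, in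
  force when the server finds its station empty.\<close>

definition polling_kernel ::
  "nat \<Rightarrow> (nat \<Rightarrow> nat \<Rightarrow> real) \<Rightarrow> (nat \<Rightarrow> nat \<Rightarrow> real) \<Rightarrow>
   (nat \<Rightarrow> nat \<Rightarrow> (nat \<Rightarrow> nat) pmf) \<Rightarrow> (nat \<Rightarrow> nat \<Rightarrow> (nat \<Rightarrow> nat) pmf) \<Rightarrow> state \<Rightarrow> state pmf" where
  "polling_kernel N P P' B B' = (\<lambda>(i, x).
     if 0 < x i
     then bind_pmf (route N P i) (\<lambda>j.
            map_pmf (\<lambda>b. (j, \<lambda>k. x k - of_bool (k = i) + b k)) (B i j))
     else bind_pmf (route N P' i) (\<lambda>j.
            map_pmf (\<lambda>b. (j, \<lambda>k. x k + b k)) (B' i j)))"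

primrec nstep :: "('s \<Rightarrow> 's pmf) \<Rightarrow> nat \<Rightarrow> 's \<Rightarrow> 's pmf" where
  "nstep K 0 s = return_pmf s"
| "nstep K (Suc n) s = bind_pmf (K s) (nstep K n)"

text \<open>\<open>first_passage K t n s\<close> is the probability that the chain with kernel \<open>K\<close> started in \<open>s\<close>
  visits \<open>t\<close> at time \<open>n + 1\<close> and at none of the times \<open>1, \<dots>, n\<close>.\<close>

primrec first_passage :: "('s \<Rightarrow> 's pmf) \<Rightarrow> 's \<Rightarrow> nat \<Rightarrow> 's \<Rightarrow> real" where
  "first_passage K t 0 s = pmf (K s) t"
| "first_passage K t (Suc n) s =
     measure_pmf.expectation (K s) (\<lambda>u. if u = t then 0 else first_passage K t n u)"

definition irreducible_chain :: "'s set \<Rightarrow> ('s \<Rightarrow> 's pmf) \<Rightarrow> bool" where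
  "irreducible_chain \<Omega> K \<longleftrightarrow> (\<forall>s\<in>\<Omega>. \<forall>t\<in>\<Omega>. \<exists>n. 0 < pmf (nstep K n s) t)"

text \<open>Ergodicity is positive recurrence: each state is revisited almost surely, with finite mean
  return time. Aperiodicity is not part of it: under cyclic routing, for instance, the
  server position is periodic.\<close>

definition ergodic_chain :: "'s set \<Rightarrow> ('s \<Rightarrow> 's pmf) \<Rightarrow> bool" where
  "ergodic_chain \<Omega> K \<longleftrightarrow>
     (\<forall>t\<in>\<Omega>. (\<lambda>n. first_passage K t n t) sums 1 \<and>
             summable (\<lambda>n. real (n + 1) * first_passage K t n t))"

definition stationary_law :: "'s set \<Rightarrow> ('s \<Rightarrow> 's pmf) \<Rightarrow> 's pmf \<Rightarrow> bool" where
  "stationary_law \<Omega> K \<pi> \<longleftrightarrow> set_pmf \<pi> \<subseteq> \<Omega> \<and> bind_pmf \<pi> K = \<pi>"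

text \<open>Only second moments are assumed, so a generating function need not converge when a variable
  exceeds 1. It is therefore used on the cube \<open>[0,1]\<^sup>N\<close> only, and partial derivatives
  at its corner \<open>(1, \<dots>, 1)\<close> are one-sided.\<close>

definition unit_cube :: "nat \<Rightarrow> (nat \<Rightarrow> real) set" where
  "unit_cube N = {z. \<forall>k\<in>{1..N}. 0 \<le> z k \<and> z k \<le> 1}"

definition gen_fun :: "nat \<Rightarrow> (nat \<Rightarrow> nat) pmf \<Rightarrow> (nat \<Rightarrow> real) \<Rightarrow> real" where
  "gen_fun N D z = measure_pmf.expectation D (\<lambda>b. \<Prod>k=1..N. z k ^ b k)"

definition partial_deriv :: "nat \<Rightarrow> ((nat \<Rightarrow> real) \<Rightarrow> complex) \<Rightarrow> (nat \<Rightarrow> real) \<Rightarrow> complex" where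
  "partial_deriv k f z = vector_derivative (\<lambda>t. f (z(k := t))) (at (z k) within {0..1})"

definition rot_symmetric ::
  "nat \<Rightarrow> (nat \<Rightarrow> nat \<Rightarrow> real) \<Rightarrow> (nat \<Rightarrow> nat \<Rightarrow> (nat \<Rightarrow> nat) pmf) \<Rightarrow>
   (nat \<Rightarrow> real) \<Rightarrow> (nat \<Rightarrow> (nat \<Rightarrow> real) \<Rightarrow> real) \<Rightarrow> bool" where
  "rot_symmetric N P B p a \<longleftrightarrow>
     (\<forall>i\<in>{1..N}. \<forall>j\<in>{1..N}. P i j = p (stn N (int j - int i)) \<and>
        (\<forall>z\<in>unit_cube N. gen_fun N (B i j) z = a (stn N (int j - int i)) z)) \<and>
     (\<forall>s\<in>{1..N}. \<forall>d\<in>{1..N}. \<forall>z\<in>unit_cube N.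
        a d z = a d (\<lambda>k. z (stn N (int k + int s))))"

definition omega :: "nat \<Rightarrow> nat \<Rightarrow> complex" where
  "omega N k = exp (2 * of_real pi * \<i> * of_nat k / of_nat N)"

definition mu :: "nat \<Rightarrow> (nat \<Rightarrow> real) \<Rightarrow> (nat \<Rightarrow> (nat \<Rightarrow> real) \<Rightarrow> real) \<Rightarrow>
    nat \<Rightarrow> (nat \<Rightarrow> real) \<Rightarrow> complex" where
  "mu N p a k z = (\<Sum>d=1..N. of_real (p d) * of_real (a d z) * omega N k ^ d)"

abbreviation ones :: "nat \<Rightarrow> real" where
  "ones \<equiv> (\<lambda>_. 1)"

definition alpha1 :: "nat \<Rightarrow> (nat \<Rightarrow> real) \<Rightarrow> (nat \<Rightarrow> (nat \<Rightarrow> real) \<Rightarrow> real) \<Rightarrow> nat \<Rightarrow> complex" where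
  "alpha1 N p a r = partial_deriv r (mu N p a N) ones"

definition alpha2 :: "nat \<Rightarrow> (nat \<Rightarrow> real) \<Rightarrow> (nat \<Rightarrow> (nat \<Rightarrow> real) \<Rightarrow> real) \<Rightarrow>
    nat \<Rightarrow> nat \<Rightarrow> complex" where
  "alpha2 N p a q d =
     partial_deriv q (partial_deriv (stn N (int q + int d)) (mu N p a N)) ones"

definition at_station :: "state pmf \<Rightarrow> nat \<Rightarrow> state pmf" where
  "at_station \<pi> m = cond_pmf \<pi> {(i, x). i = m}"

end

theory Submission
  imports Defs
begin

text \<open>
  Let \<open>b\<close> be the stationary probability that the server finds a customer at its station, and let
  \<open>u r\<close> and \<open>y r\<close> be the mean queue length \<open>r\<close> places ahead of the server, restricted to the polling
  instants that find a customer, respectively none. Stationarity, applied to three functions of the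
  state, yields three families of equations: the total number of customers gives \<open>b\<close>
  (\<open>busy_probability\<close>), the queue \<open>r\<close> places ahead of the server gives linear equations for \<open>u\<close> and
  \<open>y\<close> (\<open>first_moments\<close>), and the sum of the products of queues at distance \<open>e\<close> gives
  \<open>u e + u (- e)\<close> (\<open>second_moments_balance\<close>). In all three the arrivals enter through the means and
  the second moments of one step only, and those are the derivatives of \<open>\<mu>\<^sub>N\<close> at the corner of the
  cube (\<open>alpha1_eq\<close>, \<open>alpha2_eq\<close>).

  The equations live on the cyclic group of order \<open>N\<close> and are diagonalised by the discrete Fourier
  transform. The first moments give one complex equation for the transforms of \<open>u\<close> and \<open>y\<close> at each
  frequency \<open>k\<close>, whereas the second moments give the real part of the transform of \<open>u\<close> only. The
  identity between the routing matrices says that \<open>(1 - \<mu>\<^sub>k) / (1 - \<mu>'\<^sub>k)\<close> is real, and this is just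
  what allows taking real parts in the first equation after dividing it by the conjugate of
  \<open>1 - \<mu>'\<^sub>k\<close>. So the real part of the transform of \<open>y\<close> is known at every
  frequency but \<open>N\<close>. The remaining value, the sum of \<open>y\<close>, follows from \<open>y 0 = 0\<close>: a station that is
  found empty has no customers, so the transforms of \<open>y\<close> add up to zero
  (\<open>cyclic_moment_system\<close>). The rest is algebra (\<open>closed_form_of_means\<close>).

  Up to here all quantities are relative to the position of the server. They speak about a fixed
  station because the stationary law is invariant under rotations: the generating functions
  determine the arrival laws (\<open>pmf_eq_if_gen_fun_eq\<close>), hence rotations commute with the
  transition kernel (\<open>K_rotate\<close>) and map the stationary law to a stationary law, and an irreducible
  chain has at most one (\<open>stationary_law_unique\<close>). The denominators do not vanish since
  irreducibility gives every state positive mass, so \<open>0 < b < 1\<close>, and does not allow a system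
  that stays empty for ever (\<open>idle_alpha_pos\<close>).
\<close>

section \<open>Stationary laws of irreducible chains\<close>

lemma expectation_bind_nonneg:
  fixes f :: "'b \<Rightarrow> real"
  assumes "\<And>y. 0 \<le> f y"
    and "\<And>s. s \<in> set_pmf M \<Longrightarrow> integrable (measure_pmf (K s)) f"
  shows "measure_pmf.expectation (bind_pmf M K) f =
    measure_pmf.expectation M (\<lambda>s. measure_pmf.expectation (K s) f)"
proof -
  have "measure_pmf.expectation (bind_pmf M K) f =
      enn2real (\<integral>\<^sup>+ s. (\<integral>\<^sup>+ y. ennreal (f y) \<partial>K s) \<partial>M)"
    by (subst integral_eq_nn_integral) (auto simp: assms(1))
  also have "(\<integral>\<^sup>+ s. (\<integral>\<^sup>+ y. ennreal (f y) \<partial>K s) \<partial>M) =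
      (\<integral>\<^sup>+ s. ennreal (measure_pmf.expectation (K s) f) \<partial>M)"
    by (intro nn_integral_cong_AE)
      (auto simp: AE_measure_pmf_iff nn_integral_eq_integral assms)
  also have "enn2real \<dots> = measure_pmf.expectation M (\<lambda>s. measure_pmf.expectation (K s) f)"
    by (subst integral_eq_nn_integral) (auto simp: assms(1))
  finally show ?thesis .
qed

lemma integrable_bind_nonneg:
  fixes f :: "'b \<Rightarrow> real"
  assumes nonneg: "\<And>y. 0 \<le> f y"
    and inner: "\<And>s. s \<in> set_pmf M \<Longrightarrow> integrable (measure_pmf (K s)) f"
    and outer: "integrable (measure_pmf M) (\<lambda>s. measure_pmf.expectation (K s) f)"
  shows "integrable (measure_pmf (bind_pmf M K)) f"
proof (rule integrableI_nonneg)
  have "(\<integral>\<^sup>+ y. ennreal (f y) \<partial>bind_pmf M K) = (\<integral>\<^sup>+ s. (\<integral>\<^sup>+ y. ennreal (f y) \<partial>K s) \<partial>M)"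
    by simp
  also have "\<dots> = (\<integral>\<^sup>+ s. ennreal (measure_pmf.expectation (K s) f) \<partial>M)"
    by (intro nn_integral_cong_AE)
      (auto simp: AE_measure_pmf_iff nn_integral_eq_integral assms)
  also have "\<dots> = ennreal (measure_pmf.expectation M (\<lambda>s. measure_pmf.expectation (K s) f))"
    by (rule nn_integral_eq_integral[OF outer]) (auto simp: nonneg)
  finally show "(\<integral>\<^sup>+ y. ennreal (f y) \<partial>bind_pmf M K) < \<infinity>" by simp
qed (auto simp: nonneg)

lemma expectation_cond_pmf:
  fixes f :: "'a \<Rightarrow> real"
  assumes "set_pmf M \<inter> A \<noteq> {}"
  shows "measure_pmf.expectation (cond_pmf M A) f =
    measure_pmf.expectation M (\<lambda>x. of_bool (x \<in> A) * f x) / measure_pmf.prob M A"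
proof -
  have pos: "measure_pmf.prob M A \<noteq> 0"
    using assms by (rule measure_measure_pmf_not_zero)
  have "measure_pmf (cond_pmf M A) = density (measure_pmf M) (\<lambda>x. ennreal (indicator A x / measure_pmf.prob M A))"
    unfolding cond_pmf.rep_eq[OF assms] uniform_measure_def
    by (intro arg_cong2[where f = density] refl ext)
      (use pos in \<open>auto simp: measure_pmf.emeasure_eq_measure divide_ennreal zero_less_measure_iff
          indicator_def divide_ennreal_def[symmetric] ennreal_1[symmetric] simp del: ennreal_1\<close>)
  then have "measure_pmf.expectation (cond_pmf M A) f =
      measure_pmf.expectation M (\<lambda>x. indicator A x / measure_pmf.prob M A * f x)"
    by (simp add: integral_density)
  also have "\<dots> = measure_pmf.expectation M (\<lambda>x. of_bool (x \<in> A) * f x / measure_pmf.prob M A)"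
    by (intro Bochner_Integration.integral_cong) (auto simp: indicator_def)
  finally show ?thesis by simp
qed

lemma bind_nstep_stationary:
  assumes "bind_pmf \<pi> K = \<pi>"
  shows "bind_pmf \<pi> (nstep K n) = \<pi>"
proof (induction n)
  case 0
  show ?case by (simp add: bind_return_pmf')
next
  case (Suc n)
  have "nstep K (Suc n) = (\<lambda>s. bind_pmf (K s) (nstep K n))"
    by (rule ext) simp
  then have "bind_pmf \<pi> (nstep K (Suc n)) = bind_pmf (bind_pmf \<pi> K) (nstep K n)"
    by (simp only: bind_assoc_pmf)
  then show ?case using assms Suc by (simp only:)
qed

lemma stationary_prob_nstep:
  assumes "bind_pmf \<pi> K = \<pi>"
  shows "measure_pmf.prob \<pi> A =
    measure_pmf.expectation \<pi> (\<lambda>s. measure_pmf.prob (nstep K n s) A)"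
proof -
  have "measure_pmf.prob \<pi> A = measure_pmf.expectation (bind_pmf \<pi> (nstep K n)) (indicator A)"
    by (simp add: bind_nstep_stationary[OF assms])
  also have "\<dots> = measure_pmf.expectation \<pi> (\<lambda>s. measure_pmf.expectation (nstep K n s) (indicator A))"
    by (rule expectation_bind_nonneg) (auto intro!: integrable_real_indicator simp: measure_pmf.emeasure_eq_measure)
  finally show ?thesis by simp
qed

text \<open>If \<open>\<pi>\<close> and \<open>\<rho>\<close> are distinct stationary laws, the set \<open>A\<close> on which \<open>\<pi>\<close> exceeds \<open>\<rho>\<close>
  cannot be left: by stationarity \<open>\<pi>(A) - \<rho>(A)\<close> is the integral over \<open>s\<close> of
  \<open>(\<pi> - \<rho>)(s)\<close> times the probability of moving from \<open>s\<close> into \<open>A\<close>, which is strictly smaller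
  as soon as some \<open>s\<close> in \<open>A\<close> leads out of \<open>A\<close>.\<close>

lemma stationary_law_unique:
  assumes irr: "irreducible_chain \<Omega> K"
    and \<pi>: "stationary_law \<Omega> K \<pi>" and \<rho>: "stationary_law \<Omega> K \<rho>"
  shows "\<pi> = \<rho>"
proof (rule ccontr)
  assume ne: "\<pi> \<noteq> \<rho>"
  obtain s where s: "pmf \<rho> s < pmf \<pi> s"
    using pmf_neq_exists_less[of \<rho> \<pi>] ne by auto
  obtain t where t: "pmf \<pi> t < pmf \<rho> t"
    using pmf_neq_exists_less[of \<pi> \<rho>] ne by auto
  have "s \<in> set_pmf \<pi>" "t \<in> set_pmf \<rho>"
    using s t pmf_nonneg[of \<rho> s] pmf_nonneg[of \<pi> t] by (auto simp: set_pmf_iff)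
  then have "s \<in> \<Omega>" "t \<in> \<Omega>"
    using \<pi> \<rho> by (auto simp: stationary_law_def)
  then obtain n where n: "0 < pmf (nstep K n s) t"
    using irr by (auto simp: irreducible_chain_def)
  define A where "A = {x. pmf \<rho> x < pmf \<pi> x}"
  define g where "g x = measure_pmf.prob (nstep K n x) A" for x
  have g01: "0 \<le> g x" "g x \<le> 1" for x
    by (auto simp: g_def)
  have "g s \<le> measure_pmf.prob (nstep K n s) (- {t})"
    unfolding g_def using t by (intro measure_pmf.finite_measure_mono) (auto simp: A_def)
  also have "\<dots> = 1 - pmf (nstep K n s) t"
    using measure_pmf.prob_compl[of "{t}" "nstep K n s"]
    by (simp add: Compl_eq_Diff_UNIV measure_pmf_single)
  finally have gs: "g s < 1" using n by simp
  have step: "integrable (count_space UNIV) (\<lambda>x. pmf \<sigma> x * (indicator A x - g x)) \<and>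
      (\<integral>x. pmf \<sigma> x * (indicator A x - g x) \<partial>count_space UNIV) = 0"
    if \<sigma>: "bind_pmf \<sigma> K = \<sigma>" for \<sigma>
  proof -
    have bnd: "\<bar>indicator A x - g x\<bar> \<le> 1" for x
      using g01[of x] by (auto simp: indicator_def abs_le_iff)
    have int: "integrable \<sigma> (\<lambda>x. indicator A x - g x)"
      by (rule measure_pmf.integrable_const_bound[where B=1])
        (auto intro!: AE_I2 bnd)
    have "measure_pmf.expectation \<sigma> (\<lambda>x. indicator A x - g x) =
        measure_pmf.prob \<sigma> A - measure_pmf.expectation \<sigma> g"
      by (subst Bochner_Integration.integral_diff)
        (auto intro!: measure_pmf.integrable_const_bound[where B=1] simp: g01 indicator_def)
    also have "\<dots> = 0"
      unfolding g_def using stationary_prob_nstep[OF \<sigma>] by simp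
    finally have "measure_pmf.expectation \<sigma> (\<lambda>x. indicator A x - g x) = 0" .
    then show ?thesis
      using int unfolding measure_pmf_eq_density
      by (simp add: integral_density integrable_density)
  qed
  \<comment> \<open>This function is nonnegative on \<open>A\<close> and off \<open>A\<close>, and positive at \<open>s\<close>, but integrates to 0.\<close>
  define h where "h x = (pmf \<pi> x - pmf \<rho> x) * (indicator A x - g x)" for x
  have h_eq: "h = (\<lambda>x. pmf \<pi> x * (indicator A x - g x) - pmf \<rho> x * (indicator A x - g x))"
    by (auto simp: h_def left_diff_distrib)
  have hint: "integrable (count_space UNIV) h"
    unfolding h_eq using step[of \<pi>] step[of \<rho>] \<pi> \<rho>
    by (intro Bochner_Integration.integrable_diff) (auto simp: stationary_law_def)
  have "(\<integral>x. h x \<partial>count_space UNIV) = 0"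
    unfolding h_eq using step[of \<pi>] step[of \<rho>] \<pi> \<rho>
    by (subst Bochner_Integration.integral_diff) (auto simp: stationary_law_def)
  moreover have "0 \<le> h x" for x
    using g01[of x] by (auto simp: h_def A_def indicator_def mult_nonpos_nonneg mult_nonneg_nonpos not_less)
  ultimately have "AE x in count_space UNIV. h x = 0"
    using integral_nonneg_eq_0_iff_AE[OF hint] by simp
  then have "h s = 0" by (simp add: AE_count_space)
  then show False
    using s gs by (simp add: h_def A_def)
qed

lemma stationary_law_positive:
  assumes irr: "irreducible_chain \<Omega> K" and \<pi>: "stationary_law \<Omega> K \<pi>" and t: "t \<in> \<Omega>"
  shows "0 < pmf \<pi> t"
proof -
  obtain s where s: "s \<in> set_pmf \<pi>" using set_pmf_not_empty[of \<pi>] by auto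
  then have "s \<in> \<Omega>" using \<pi> by (auto simp: stationary_law_def)
  then obtain n where "0 < pmf (nstep K n s) t"
    using irr t by (auto simp: irreducible_chain_def)
  then have "t \<in> set_pmf (bind_pmf \<pi> (nstep K n))"
    using s by (auto simp: set_pmf_iff intro!: bexI[of _ s])
  also have "bind_pmf \<pi> (nstep K n) = \<pi>"
    using \<pi> by (intro bind_nstep_stationary) (simp add: stationary_law_def)
  finally show ?thesis by (rule pmf_positive)
qed

lemma set_nstep_invariant:
  assumes "\<And>s. s \<in> C \<Longrightarrow> set_pmf (K s) \<subseteq> C" and "s \<in> C"
  shows "set_pmf (nstep K n s) \<subseteq> C"
  using assms(2)
proof (induction n arbitrary: s)
  case (Suc n)
  then show ?case using assms(1) by fastforce
qed simp

lemma integrable_mult_of_squares: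
  fixes f g :: "'a \<Rightarrow> real"
  assumes "integrable (measure_pmf M) (\<lambda>x. (f x)\<^sup>2)" "integrable (measure_pmf M) (\<lambda>x. (g x)\<^sup>2)"
  shows "integrable (measure_pmf M) (\<lambda>x. f x * g x)"
proof (rule Bochner_Integration.integrable_bound[OF Bochner_Integration.integrable_add[OF assms]])
  have "\<bar>f x * g x\<bar> \<le> (f x)\<^sup>2 + (g x)\<^sup>2" for x
  proof -
    have "0 \<le> (\<bar>f x\<bar> - \<bar>g x\<bar>)\<^sup>2" by simp
    then have "2 * (\<bar>f x\<bar> * \<bar>g x\<bar>) \<le> (f x)\<^sup>2 + (g x)\<^sup>2"
      by (simp add: power2_diff)
    moreover have "0 \<le> \<bar>f x\<bar> * \<bar>g x\<bar>" by simp
    ultimately show ?thesis unfolding abs_mult by linarith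
  qed
  then show "AE x in measure_pmf M. norm (f x * g x) \<le> norm ((f x)\<^sup>2 + (g x)\<^sup>2)"
    by (intro AE_I2) (simp add: abs_mult[symmetric])
qed simp

lemma integrable_of_square:
  fixes f :: "'a \<Rightarrow> real"
  assumes "integrable (measure_pmf M) (\<lambda>x. (f x)\<^sup>2)"
  shows "integrable (measure_pmf M) f"
  using integrable_mult_of_squares[OF assms, of "\<lambda>_. 1"] by simp

section \<open>Generating functions on the unit cube\<close>

text \<open>Dominated convergence of the difference quotients: on the unit interval \<open>t \<mapsto> t ^ k\<close> is
  Lipschitz with constant \<open>k\<close>, so \<open>\<bar>w b * g b\<bar>\<close> bounds the quotients, up to the
  endpoint 1.\<close>

lemma expectation_power_derivative:
  fixes w :: "'b \<Rightarrow> real" and g :: "'b \<Rightarrow> nat"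
  assumes w: "integrable (measure_pmf D) w"
    and wg: "integrable (measure_pmf D) (\<lambda>b. w b * real (g b))"
    and s: "s \<in> {0..1}"
  shows "((\<lambda>t. measure_pmf.expectation D (\<lambda>b. w b * t ^ g b)) has_real_derivative
    measure_pmf.expectation D (\<lambda>b. w b * (real (g b) * s ^ (g b - 1)))) (at s within {0..1})"
proof -
  define F where "F t = measure_pmf.expectation D (\<lambda>b. w b * t ^ g b)" for t
  have int: "integrable (measure_pmf D) (\<lambda>b. w b * t ^ g b)" if "t \<in> {0..1}" for t
    by (rule Bochner_Integration.integrable_bound[OF w])
      (use that in \<open>auto simp: abs_mult power_le_one intro!: mult_left_le\<close>)
  have lip: "\<bar>t ^ k - s ^ k\<bar> \<le> real k * \<bar>t - s\<bar>" if "t \<in> {0..1}" for t :: real and k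
  proof (induction k)
    case (Suc k)
    have "t ^ Suc k - s ^ Suc k = t * (t ^ k - s ^ k) + (t - s) * s ^ k"
      by (simp add: algebra_simps)
    also have "\<bar>\<dots>\<bar> \<le> \<bar>t * (t ^ k - s ^ k)\<bar> + \<bar>(t - s) * s ^ k\<bar>"
      by (rule abs_triangle_ineq)
    also have "\<dots> \<le> 1 * (real k * \<bar>t - s\<bar>) + \<bar>t - s\<bar> * 1"
      unfolding abs_mult using that s Suc
      by (intro add_mono mult_mono) (auto simp: power_le_one)
    finally show ?case by (simp add: algebra_simps)
  qed simp
  have "(\<lambda>i. (F (X i) - F s) / (X i - s))
      \<longlonglongrightarrow> measure_pmf.expectation D (\<lambda>b. w b * (real (g b) * s ^ (g b - 1)))"
    if X: "\<And>i. X i \<in> {0..1} - {s}" "X \<longlonglongrightarrow> s" for X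
  proof -
    define h where "h i b = w b * ((X i ^ g b - s ^ g b) / (X i - s))" for i b
    have "(F (X i) - F s) / (X i - s) = measure_pmf.expectation D (h i)" for i
    proof -
      have "F (X i) - F s = measure_pmf.expectation D (\<lambda>b. w b * X i ^ g b - w b * s ^ g b)"
        unfolding F_def using X(1)[of i] s by (subst Bochner_Integration.integral_diff) (auto intro: int)
      moreover have "h i = (\<lambda>b. (w b * X i ^ g b - w b * s ^ g b) / (X i - s))"
        by (auto simp: h_def right_diff_distrib)
      ultimately show ?thesis by simp
    qed
    moreover have "(\<lambda>i. measure_pmf.expectation D (h i))
        \<longlonglongrightarrow> measure_pmf.expectation D (\<lambda>b. w b * (real (g b) * s ^ (g b - 1)))"
    proof (rule integral_dominated_convergence[where w = "\<lambda>b. \<bar>w b * real (g b)\<bar>"])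
      show "AE b in measure_pmf D. (\<lambda>i. h i b) \<longlonglongrightarrow> w b * (real (g b) * s ^ (g b - 1))"
      proof (rule AE_I2)
        fix b
        have "((\<lambda>t. t ^ g b) has_real_derivative real (g b) * s ^ (g b - 1)) (at s within {0..1})"
          by (auto intro!: derivative_eq_intros)
        then have "((\<lambda>t. (t ^ g b - s ^ g b) / (t - s)) \<longlongrightarrow> real (g b) * s ^ (g b - 1)) (at s within {0..1})"
          by (simp add: has_field_derivative_iff)
        then have "(\<lambda>i. (X i ^ g b - s ^ g b) / (X i - s)) \<longlonglongrightarrow> real (g b) * s ^ (g b - 1)"
          using X by (auto simp: tendsto_at_iff_sequentially comp_def)
        then show "(\<lambda>i. h i b) \<longlonglongrightarrow> w b * (real (g b) * s ^ (g b - 1))"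
          unfolding h_def by (intro tendsto_mult tendsto_const)
      qed
      show "AE b in measure_pmf D. norm (h i b) \<le> \<bar>w b * real (g b)\<bar>" for i
      proof (rule AE_I2)
        fix b
        have "\<bar>(X i ^ g b - s ^ g b) / (X i - s)\<bar> \<le> real (g b)"
          using lip[of "X i" "g b"] X(1)[of i] by (simp add: abs_divide divide_le_eq)
        then show "norm (h i b) \<le> \<bar>w b * real (g b)\<bar>"
          unfolding h_def real_norm_def abs_mult by (intro mult_left_mono) auto
      qed
      show "integrable (measure_pmf D) (\<lambda>b. \<bar>w b * real (g b)\<bar>)"
        using wg by simp
    qed auto
    ultimately show ?thesis by simp
  qed
  then show ?thesis
    unfolding has_field_derivative_iff tendsto_at_iff_sequentially comp_def F_def by blast
qed

text \<open>The terms of degree below \<open>n\<close> are split off the power series \<open>t \<mapsto> E (v t\<^sup>h)\<close>; what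
  remains is \<open>t ^ n\<close> times a series with constant term \<open>E (v; h = n)\<close>, which is read off by
  letting \<open>t\<close> tend to 0.\<close>

lemma expectation_power_split:
  fixes v :: "'d \<Rightarrow> real" and h :: "'d \<Rightarrow> nat"
  assumes v: "integrable (measure_pmf M) v" and t: "0 \<le> t" "t \<le> 1"
  shows "measure_pmf.expectation M (\<lambda>b. v b * t ^ h b) =
    (\<Sum>k<n. measure_pmf.expectation M (\<lambda>b. v b * of_bool (h b = k)) * t ^ k) +
    t ^ n * measure_pmf.expectation M (\<lambda>b. v b * (of_bool (n \<le> h b) * t ^ (h b - n)))"
proof -
  have "v b * t ^ h b = (\<Sum>k<n. v b * of_bool (h b = k) * t ^ k) +
      t ^ n * (v b * (of_bool (n \<le> h b) * t ^ (h b - n)))" for b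
  proof (cases "h b < n")
    case True
    have "(\<Sum>k<n. v b * of_bool (h b = k) * t ^ k) = (\<Sum>k<n. if k = h b then v b * t ^ h b else 0)"
      by (intro sum.cong) auto
    then show ?thesis using True by simp
  next
    case False
    then have "(\<Sum>k<n. v b * of_bool (h b = k) * t ^ k) = 0"
      by (intro sum.neutral) auto
    then show ?thesis using False by (simp flip: power_add)
  qed
  moreover have "integrable (measure_pmf M) (\<lambda>b. v b * of_bool (h b = k))" for k
    by (rule Bochner_Integration.integrable_bound[OF v]) auto
  moreover have "integrable (measure_pmf M) (\<lambda>b. v b * (of_bool (n \<le> h b) * t ^ (h b - n)))"
    by (rule Bochner_Integration.integrable_bound[OF v])
      (use t in \<open>auto simp: abs_mult power_le_one intro!: mult_left_le\<close>)
  ultimately show ?thesis by simp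
qed

lemma expectation_power_limit:
  fixes v :: "'d \<Rightarrow> real" and h :: "'d \<Rightarrow> nat"
  assumes v: "integrable (measure_pmf M) v"
  shows "(\<lambda>i. measure_pmf.expectation M (\<lambda>b. v b * (of_bool (n \<le> h b) * inverse (real (Suc i)) ^ (h b - n))))
    \<longlonglongrightarrow> measure_pmf.expectation M (\<lambda>b. v b * of_bool (h b = n))"
proof (rule integral_dominated_convergence[where w = "\<lambda>b. \<bar>v b\<bar>"])
  show "AE b in measure_pmf M. (\<lambda>i. v b * (of_bool (n \<le> h b) * inverse (real (Suc i)) ^ (h b - n)))
      \<longlonglongrightarrow> v b * of_bool (h b = n)"
  proof (rule AE_I2)
    fix b
    have "(\<lambda>i. of_bool (n \<le> h b) * inverse (real (Suc i)) ^ (h b - n)) \<longlonglongrightarrow> of_bool (n \<le> h b) * 0 ^ (h b - n)"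
      by (intro tendsto_intros LIMSEQ_inverse_real_of_nat)
    moreover have "of_bool (n \<le> h b) * 0 ^ (h b - n) = (of_bool (h b = n) :: real)"
      by (auto simp: power_0_left)
    ultimately show "(\<lambda>i. v b * (of_bool (n \<le> h b) * inverse (real (Suc i)) ^ (h b - n)))
        \<longlonglongrightarrow> v b * of_bool (h b = n)"
      by (intro tendsto_mult tendsto_const) simp
  qed
  show "AE b in measure_pmf M.
      norm (v b * (of_bool (n \<le> h b) * inverse (real (Suc i)) ^ (h b - n))) \<le> \<bar>v b\<bar>" for i
    by (rule AE_I2) (auto simp: abs_mult intro!: mult_left_le power_le_one inverse_le_1_iff[THEN iffD2])
  show "integrable (measure_pmf M) (\<lambda>b. \<bar>v b\<bar>)"
    using v by simp
qed auto

text \<open>Equal power series have equal coefficients. By induction the terms of degree below \<open>n\<close> agree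
  and can be removed; dividing by \<open>t ^ n\<close> and letting \<open>t\<close> tend to 0 compares the next
  coefficient.\<close>

lemma expectation_power_coefficients_eq:
  fixes w :: "'b \<Rightarrow> real" and w' :: "'c \<Rightarrow> real" and g :: "'b \<Rightarrow> nat" and g' :: "'c \<Rightarrow> nat"
  assumes w: "integrable (measure_pmf D) w" and w': "integrable (measure_pmf D') w'"
    and eq: "\<And>t. 0 \<le> t \<Longrightarrow> t \<le> 1 \<Longrightarrow>
      measure_pmf.expectation D (\<lambda>b. w b * t ^ g b) = measure_pmf.expectation D' (\<lambda>b. w' b * t ^ g' b)"
  shows "measure_pmf.expectation D (\<lambda>b. w b * of_bool (g b = n)) =
    measure_pmf.expectation D' (\<lambda>b. w' b * of_bool (g' b = n))"
proof (induction n rule: less_induct)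
  case (less n)
  have "measure_pmf.expectation D (\<lambda>b. w b * (of_bool (n \<le> g b) * t ^ (g b - n))) =
      measure_pmf.expectation D' (\<lambda>b. w' b * (of_bool (n \<le> g' b) * t ^ (g' b - n)))"
    if "0 < t" "t \<le> 1" for t
    using eq[of t] expectation_power_split[OF w, of t g n] expectation_power_split[OF w', of t g' n] less that by simp
  then have along: "measure_pmf.expectation D (\<lambda>b. w b * (of_bool (n \<le> g b) * inverse (real (Suc i)) ^ (g b - n))) =
      measure_pmf.expectation D' (\<lambda>b. w' b * (of_bool (n \<le> g' b) * inverse (real (Suc i)) ^ (g' b - n)))" for i
    using inverse_le_1_iff[of "real (Suc i)"] by auto
  show ?case
    using LIMSEQ_unique[OF expectation_power_limit[OF w, of n g, unfolded along]
      expectation_power_limit[OF w', of n g']] .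
qed

lemma expectation_point_indicator:
  assumes M: "set_pmf M \<subseteq> queue_space N" and c: "c \<in> queue_space N"
  shows "measure_pmf.expectation M (\<lambda>b. \<Prod>k\<in>{1..N}. of_bool (b k = c k)) = pmf M c"
proof -
  have "(\<Prod>k\<in>{1..N}. of_bool (b k = c k)) = (indicator {c} b :: real)" if "b \<in> set_pmf M" for b
  proof (cases "b = c")
    case False
    then obtain k where k: "b k \<noteq> c k" by auto
    moreover have "b \<in> queue_space N" using M that by auto
    ultimately have "k \<in> {1..N}"
      using c by (metis (mono_tags, lifting) mem_Collect_eq queue_space_def)
    then show ?thesis using k False by (auto intro!: prod_zero)
  qed simp
  then have "measure_pmf.expectation M (\<lambda>b. \<Prod>k\<in>{1..N}. of_bool (b k = c k)) =
      measure_pmf.expectation M (indicat_real {c})"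
    by (intro integral_cong_AE) (auto simp: AE_measure_pmf_iff)
  then show ?thesis by (simp add: measure_pmf_single)
qed

text \<open>The coordinates are treated one after the other: for a set \<open>J\<close> of coordinates the factors
  \<open>z k ^ b k\<close> with \<open>k \<in> J\<close> are replaced by indicators of \<open>b k = c k\<close>. Each single replacement
  compares the coefficients of power series in one variable, and for \<open>J = {1..N}\<close> the
  expectation is the mass at \<open>c\<close>.\<close>

lemma pmf_eq_if_gen_fun_eq:
  assumes D: "set_pmf D \<subseteq> queue_space N" and D': "set_pmf D' \<subseteq> queue_space N"
    and eq: "\<And>z. z \<in> unit_cube N \<Longrightarrow> gen_fun N D z = gen_fun N D' z"
  shows "D = D'"
proof (rule pmf_eqI)
  fix c :: "nat \<Rightarrow> nat"
  define w where "w J z b = (\<Prod>k\<in>J. of_bool (b k = c k)) * (\<Prod>k\<in>{1..N}-J. z k ^ b k)"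
    for J and z :: "nat \<Rightarrow> real" and b :: "nat \<Rightarrow> nat"
  have w01: "0 \<le> w J z b \<and> w J z b \<le> 1" if "z \<in> unit_cube N" for J z b
    unfolding w_def using that
    by (auto simp: unit_cube_def intro!: mult_nonneg_nonneg prod_nonneg mult_le_one prod_le_1 power_le_one)
  have w_int: "integrable (measure_pmf M) (w J z)" if "z \<in> unit_cube N" for M J z
    using w01[OF that] by (intro measure_pmf.integrable_const_bound[where B=1]) (auto simp: abs_le_iff intro!: AE_I2 order_trans[of _ 0])
  have "measure_pmf.expectation D (w J z) = measure_pmf.expectation D' (w J z)"
    if "finite J" "J \<subseteq> {1..N}" "z \<in> unit_cube N" for J z
    using that
  proof (induction J arbitrary: z rule: finite_induct)
    case empty
    then show ?case using eq[of z] by (simp add: w_def gen_fun_def)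
  next
    case (insert k J)
    have z1: "z(k := t) \<in> unit_cube N" if "0 \<le> t" "t \<le> 1" for t
      using that insert.prems by (auto simp: unit_cube_def)
    define v where "v = w J (z(k := 1))"
    have split: "{1..N} - J = insert k ({1..N} - insert k J)" "k \<notin> {1..N} - insert k J"
      using insert by auto
    have rest: "(\<Prod>x\<in>{1..N} - insert k J. (z(k := t)) x ^ b x) = (\<Prod>x\<in>{1..N} - insert k J. z x ^ b x)" for t b
      by (intro prod.cong) auto
    have pow: "w J (z(k := t)) = (\<lambda>b. v b * t ^ b k)" for t
    proof
      fix b
      have "(\<Prod>x\<in>{1..N} - J. (z(k := s)) x ^ b x) = s ^ b k * (\<Prod>x\<in>{1..N} - insert k J. z x ^ b x)" for s
        unfolding split(1) using split(2) by (subst prod.insert) (auto simp only: rest fun_upd_same finite_Diff finite_atLeastAtMost finite_insert)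
      then show "w J (z(k := t)) b = v b * t ^ b k"
        unfolding v_def w_def by simp
    qed
    have ind: "w (insert k J) z = (\<lambda>b. v b * of_bool (b k = c k))"
    proof
      fix b
      have "(\<Prod>x\<in>{1..N} - J. (z(k := 1)) x ^ b x) = (\<Prod>x\<in>{1..N} - insert k J. z x ^ b x)"
        unfolding split(1) using split(2) by (subst prod.insert) (auto simp only: rest fun_upd_same power_one mult_1 finite_Diff finite_atLeastAtMost finite_insert)
      then show "w (insert k J) z b = v b * of_bool (b k = c k)"
        unfolding v_def w_def prod.insert[OF insert.hyps(1,2)] by simp
    qed
    show ?case
      unfolding ind
    proof (rule expectation_power_coefficients_eq)
      show "integrable (measure_pmf D) v" "integrable (measure_pmf D') v"
        unfolding v_def by (auto intro!: w_int z1)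
      show "measure_pmf.expectation D (\<lambda>b. v b * t ^ b k) = measure_pmf.expectation D' (\<lambda>b. v b * t ^ b k)"
        if "0 \<le> t" "t \<le> 1" for t
        using insert.IH[OF _ z1[OF that]] insert.prems unfolding pow by blast
    qed
  qed
  then have "measure_pmf.expectation D (w {1..N} (\<lambda>_. 1)) = measure_pmf.expectation D' (w {1..N} (\<lambda>_. 1))"
    by (auto simp: unit_cube_def)
  moreover have "w {1..N} (\<lambda>_. 1) = (\<lambda>b. \<Prod>k\<in>{1..N}. of_bool (b k = c k))"
    by (rule ext) (simp add: w_def)
  ultimately have main: "measure_pmf.expectation D (\<lambda>b. \<Prod>k\<in>{1..N}. of_bool (b k = c k)) =
      measure_pmf.expectation D' (\<lambda>b. \<Prod>k\<in>{1..N}. of_bool (b k = c k) :: real)"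
    by (simp only:)
  show "pmf D c = pmf D' c"
  proof (cases "c \<in> queue_space N")
    case True
    show ?thesis
      using main unfolding expectation_point_indicator[OF D True] expectation_point_indicator[OF D' True] .
  next
    case False
    then have "c \<notin> set_pmf D" "c \<notin> set_pmf D'" using D D' by auto
    then show ?thesis by (simp add: set_pmf_iff)
  qed
qed

section \<open>Cyclic indices and discrete Fourier transforms\<close>

lemma stn_in: "1 \<le> N \<Longrightarrow> stn N k \<in> {1..N}"
  unfolding stn_def by (auto simp: nat_less_iff Suc_le_eq)

lemma int_stn: "1 \<le> N \<Longrightarrow> int (stn N k) = (k - 1) mod int N + 1"
  unfolding stn_def by simp

lemma stn_eq_iff: "1 \<le> N \<Longrightarrow> stn N k = stn N l \<longleftrightarrow> k mod int N = l mod int N"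
proof -
  assume N: "1 \<le> N"
  have "stn N k = stn N l \<longleftrightarrow> (k - 1) mod int N = (l - 1) mod int N"
    using int_stn[OF N, of k] int_stn[OF N, of l] by linarith
  also have "\<dots> \<longleftrightarrow> k mod int N = l mod int N"
    by (simp add: mod_eq_dvd_iff)
  finally show ?thesis .
qed

lemma stn_mod: "1 \<le> N \<Longrightarrow> int (stn N k) mod int N = k mod int N"
  by (simp add: int_stn mod_simps)

lemma stn_id: "k \<in> {1..N} \<Longrightarrow> stn N (int k) = k"
  unfolding stn_def by (simp add: nat_diff_distrib)

lemma stn_stn: "1 \<le> N \<Longrightarrow> stn N (int (stn N k)) = stn N k"
  by (intro stn_id stn_in)

lemma stn_add_left: "1 \<le> N \<Longrightarrow> stn N (int (stn N k) + l) = stn N (k + l)"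
  by (simp add: stn_eq_iff) (rule mod_add_cong, simp_all add: stn_mod)

lemma stn_add_right: "1 \<le> N \<Longrightarrow> stn N (l + int (stn N k)) = stn N (l + k)"
  by (simp add: stn_eq_iff) (rule mod_add_cong, simp_all add: stn_mod)

lemma stn_diff_left: "1 \<le> N \<Longrightarrow> stn N (int (stn N k) - l) = stn N (k - l)"
  using stn_add_left[of N k "- l"] by simp

lemma stn_diff_right: "1 \<le> N \<Longrightarrow> stn N (l - int (stn N k)) = stn N (l - k)"
  by (simp add: stn_eq_iff) (rule mod_diff_cong, simp_all add: stn_mod)

lemmas stn_simps = stn_id stn_stn stn_add_left stn_add_right stn_diff_left stn_diff_right

lemma bij_betw_stn_shift:
  assumes "1 \<le> N"
  shows "bij_betw (\<lambda>d. stn N (c + int d)) {1..N} {1..N}"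
  using assms
  by (intro bij_betwI[where g = "\<lambda>d. stn N (int d - c)"])
    (auto simp del: atLeastAtMost_iff One_nat_def simp: stn_simps stn_in)

lemma bij_betw_stn_uminus:
  assumes "1 \<le> N"
  shows "bij_betw (\<lambda>d. stn N (c - int d)) {1..N} {1..N}"
  using assms
  by (intro bij_betwI[where g = "\<lambda>d. stn N (c - int d)"])
    (auto simp del: atLeastAtMost_iff One_nat_def simp: stn_simps stn_in)

text \<open>Functions on the integers modulo \<open>N\<close> are represented by periodic functions on \<open>int\<close>, so that
  shifts and reflections of stations become ordinary arithmetic.\<close>

definition cyclic :: "nat \<Rightarrow> (int \<Rightarrow> 'a) \<Rightarrow> bool" where
  "cyclic N f \<longleftrightarrow> (\<forall>r. f (int (stn N r)) = f r)"

lemma cyclicD: "cyclic N f \<Longrightarrow> f (int (stn N r)) = f r"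
  by (simp add: cyclic_def)

lemma cyclic_0: "1 \<le> N \<Longrightarrow> cyclic N f \<Longrightarrow> f (int N) = f 0"
  using cyclicD[of N f "int N"] cyclicD[of N f 0] stn_eq_iff[of N "int N" 0] by simp

lemma sum_stn_shift:
  fixes f :: "nat \<Rightarrow> 'a::comm_monoid_add"
  assumes "1 \<le> N"
  shows "(\<Sum>d=1..N. f (stn N (c + int d))) = (\<Sum>d=1..N. f d)"
  by (rule sum.reindex_bij_betw[OF bij_betw_stn_shift[OF assms]])

lemma sum_stn_uminus:
  fixes f :: "nat \<Rightarrow> 'a::comm_monoid_add"
  assumes "1 \<le> N"
  shows "(\<Sum>d=1..N. f (stn N (c - int d))) = (\<Sum>d=1..N. f d)"
  by (rule sum.reindex_bij_betw[OF bij_betw_stn_uminus[OF assms]])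

lemma sum_cyclic_shift:
  fixes f :: "int \<Rightarrow> 'a::comm_monoid_add"
  assumes "1 \<le> N" "cyclic N f"
  shows "(\<Sum>d=1..N. f (c + int d)) = (\<Sum>d=1..N. f (int d))"
  using sum_stn_shift[OF assms(1), of "\<lambda>d. f (int d)" c] by (simp add: cyclicD[OF assms(2)])

lemma sum_cyclic_uminus:
  fixes f :: "int \<Rightarrow> 'a::comm_monoid_add"
  assumes "1 \<le> N" "cyclic N f"
  shows "(\<Sum>d=1..N. f (c - int d)) = (\<Sum>d=1..N. f (int d))"
  using sum_stn_uminus[OF assms(1), of "\<lambda>d. f (int d)" c] by (simp add: cyclicD[OF assms(2)])

text \<open>The characters of the cyclic group of order \<open>N\<close>; \<open>character N k r\<close> is \<open>\<omega>\<^sub>k ^ r\<close>.\<close>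

definition character :: "nat \<Rightarrow> nat \<Rightarrow> int \<Rightarrow> complex" where
  "character N k r = cis (2 * pi * real k * real_of_int r / real N)"

lemma omega_power: "omega N k ^ d = character N k (int d)"
proof -
  have "omega N k = cis (2 * pi * real k / real N)"
    unfolding omega_def cis_conv_exp by (simp add: mult_ac)
  then show ?thesis by (simp add: Complex.DeMoivre character_def mult_ac)
qed

lemma character_add: "character N k (r + s) = character N k r * character N k s"
  unfolding character_def by (simp add: cis_mult add_divide_distrib[symmetric] algebra_simps)

lemma character_uminus: "character N k (- r) = cnj (character N k r)"
  unfolding character_def by (simp add: cis_cnj)

lemma character_diff: "character N k (r - s) = character N k r * cnj (character N k s)"
  using character_add[of N k r "- s"] by (simp add: character_uminus)

lemma character_swap: "character N k (int d) = character N d (int k)"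
  by (simp add: character_def mult_ac)

lemma character_multiple: "1 \<le> N \<Longrightarrow> character N k (int N * q) = 1"
  using cis_multiple_2pi[of "of_int (int k * q)"] by (simp add: character_def mult_ac)

lemma cyclic_character: "1 \<le> N \<Longrightarrow> cyclic N (character N k)"
  unfolding cyclic_def
proof
  fix r assume N: "1 \<le> N"
  have "int N dvd int (stn N r) - r"
    using stn_mod[OF N, of r] by (simp add: mod_eq_dvd_iff)
  then obtain q where "int (stn N r) = r + int N * q" by (auto simp: dvd_def algebra_simps)
  then show "character N k (int (stn N r)) = character N k r"
    using N by (simp add: character_add character_multiple)
qed

lemma character_full: "1 \<le> N \<Longrightarrow> character N N r = 1"
  using cis_multiple_2pi[of "of_int r"] by (simp add: character_def mult_ac)

lemma character_complement:
  assumes "1 \<le> N" "k \<le> N"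
  shows "character N (N - k) (int d) = cnj (character N k (int d))"
proof -
  have "character N (N - k) (int d) = character N d (int N - int k)"
    using assms by (subst character_swap) (simp add: of_nat_diff)
  then show ?thesis
    using character_full[OF assms(1)] by (simp add: character_diff character_swap[of N d])
qed

lemma character_1_neq_1:
  assumes "1 \<le> k" "k < N"
  shows "character N k 1 \<noteq> 1"
proof
  assume "character N k 1 = 1"
  then have "cos (2 * pi * real k / real N) = 1"
    by (simp add: character_def complex_eq_iff)
  then obtain j :: int where "2 * pi * real k / real N = of_int j * 2 * pi"
    using cos_one_2pi_int by blast
  then have "real k = of_int j * real N"
    using assms by (simp add: field_simps)
  then have "int k = j * int N"
    by (metis of_int_eq_iff of_int_mult of_int_of_nat_eq)
  then have "N dvd k" by (metis dvd_triv_right int_dvd_int_iff)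
  then show False using assms by (auto dest: dvd_imp_le)
qed

text \<open>The sum is invariant under multiplication by \<open>character N k 1\<close>, which is not 1.\<close>

lemma sum_character_eq_0:
  assumes "1 \<le> k" "k < N"
  shows "(\<Sum>d=1..N. character N k (int d)) = 0"
proof -
  have "(\<Sum>d=1..N. character N k (int d)) = (\<Sum>d=1..N. character N k (1 + int d))"
    using assms by (subst sum_cyclic_shift) (auto intro: cyclic_character)
  also have "\<dots> = character N k 1 * (\<Sum>d=1..N. character N k (int d))"
    by (simp add: character_add sum_distrib_left)
  finally show ?thesis using character_1_neq_1[OF assms] by auto
qed

definition fourier :: "nat \<Rightarrow> (int \<Rightarrow> real) \<Rightarrow> nat \<Rightarrow> complex" where
  "fourier N f k = (\<Sum>d=1..N. of_real (f (int d)) * character N k (int d))"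

lemma fourier_shift:
  assumes "1 \<le> N" "cyclic N f"
  shows "(\<Sum>d=1..N. of_real (f (int d + c)) * character N k (int d)) = cnj (character N k c) * fourier N f k"
proof -
  have cyc: "cyclic N (\<lambda>r. of_real (f r) * character N k (r - c))"
    using assms cyclic_character[of N k] by (simp add: cyclic_def character_diff)
  have "(\<Sum>d=1..N. of_real (f (int d + c)) * character N k (int d)) =
      (\<Sum>d=1..N. (\<lambda>r. of_real (f r) * character N k (r - c)) (c + int d))"
    by (simp add: add.commute)
  also have "\<dots> = (\<Sum>d=1..N. of_real (f (int d)) * character N k (int d - c))"
    by (rule sum_cyclic_shift[OF assms(1) cyc])
  also have "\<dots> = cnj (character N k c) * fourier N f k"
    by (simp add: fourier_def character_diff sum_distrib_left mult_ac)
  finally show ?thesis .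
qed

lemma fourier_reflect:
  assumes "1 \<le> N" "cyclic N f"
  shows "(\<Sum>d=1..N. of_real (f (- int d)) * character N k (int d)) = cnj (fourier N f k)"
proof -
  have cyc: "cyclic N (\<lambda>r. of_real (f r) * character N k (- r))"
    using assms cyclic_character[of N k] by (simp add: cyclic_def character_uminus)
  have "(\<Sum>d=1..N. of_real (f (- int d)) * character N k (int d)) =
      (\<Sum>d=1..N. (\<lambda>r. of_real (f r) * character N k (- r)) (0 - int d))"
    by simp
  also have "\<dots> = (\<Sum>d=1..N. of_real (f (int d)) * character N k (- int d))"
    by (rule sum_cyclic_uminus[OF assms(1) cyc])
  also have "\<dots> = cnj (fourier N f k)"
    by (simp add: fourier_def character_uminus)
  finally show ?thesis .
qed

lemma fourier_full: "1 \<le> N \<Longrightarrow> fourier N f N = of_real (\<Sum>d=1..N. f (int d))"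
  by (simp add: fourier_def character_full)

lemma fourier_complement:
  assumes "1 \<le> N" "k \<le> N"
  shows "fourier N f (N - k) = cnj (fourier N f k)"
  using assms by (simp add: fourier_def character_complement)

text \<open>Fourier inversion at 0.\<close>

lemma sum_fourier:
  assumes "1 \<le> N" "cyclic N f"
  shows "(\<Sum>k=1..N. fourier N f k) = of_nat N * of_real (f 0)"
proof -
  have "(\<Sum>k=1..N. fourier N f k) = (\<Sum>d=1..N. of_real (f (int d)) * (\<Sum>k=1..N. character N d (int k)))"
    unfolding fourier_def sum_distrib_left by (subst sum.swap) (simp add: character_swap)
  also have "\<dots> = (\<Sum>d=1..N. if d = N then of_nat N * of_real (f (int N)) else 0)"
  proof (intro sum.cong refl)
    fix d assume "d \<in> {1..N}"
    then show "of_real (f (int d)) * (\<Sum>k=1..N. character N d (int k)) =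
        (if d = N then of_nat N * of_real (f (int N)) else 0)"
      using assms sum_character_eq_0[of d N] by (cases "d = N") (auto simp: character_full)
  qed
  also have "\<dots> = of_nat N * of_real (f 0)"
    using assms by (simp add: cyclic_0)
  finally show ?thesis .
qed

lemma sum_reflect_index:
  fixes f :: "nat \<Rightarrow> 'a::comm_monoid_add"
  shows "(\<Sum>l=1..<N. f (N - l)) = (\<Sum>l=1..<N. f l)"
  by (rule sum.reindex_bij_witness[where i = "\<lambda>l. N - l" and j = "\<lambda>l. N - l"]) auto

text \<open>The characters are eigenvectors of circulant matrices and of their transposes, with conjugate
  eigenvalues.\<close>

lemma fourier_circulant_row:
  assumes "1 \<le> N" "cyclic N q"
  shows "(\<Sum>j=1..N. of_real (q (int j - l)) * character N k (int j)) = character N k l * fourier N q k"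
  using fourier_shift[OF assms, of "- l" k] by (simp add: character_uminus)

lemma fourier_circulant_column:
  assumes "1 \<le> N" "cyclic N q"
  shows "(\<Sum>j=1..N. of_real (q (l - int j)) * character N k (int j)) = character N k l * cnj (fourier N q k)"
proof -
  have cyc: "cyclic N (\<lambda>r. of_real (q r) * character N k (l - r))"
    using assms cyclic_character[of N k] by (simp add: cyclic_def character_diff)
  have "(\<Sum>j=1..N. of_real (q (l - int j)) * character N k (int j)) =
      (\<Sum>j=1..N. (\<lambda>r. of_real (q r) * character N k (l - r)) (l - int j))"
    by simp
  also have "\<dots> = (\<Sum>d=1..N. of_real (q (int d)) * character N k (l - int d))"
    by (rule sum_cyclic_uminus[OF assms(1) cyc])
  finally show ?thesis
    by (simp add: fourier_def character_diff sum_distrib_left mult_ac)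
qed

section \<open>Solving the moment equations\<close>

text \<open>At a frequency \<open>k\<close> from 1 to \<open>N - 1\<close> the constants \<open>h\<close> and \<open>V\<close> disappear. With
  \<open>\<rho> k = (1 - fourier N p k) / (1 - fourier N p' k)\<close>, which \<open>comm\<close> makes real, the first equation
  divided by \<open>1 - cnj (fourier N p' k)\<close> expresses the transform of \<open>y\<close> by \<open>\<rho> k\<close> times that of
  \<open>u\<close> and known terms, so its real part involves only the real part of the transform of \<open>u\<close>, which the second
  equation provides. As \<open>y 0 = 0\<close>, the transforms of \<open>y\<close> sum to zero over all frequencies, and
  this determines the one at frequency \<open>N\<close>, the sum of \<open>y\<close>.\<close>

lemma cyclic_moment_system:
  fixes p p' u y c :: "int \<Rightarrow> real" and b h V :: real
  assumes N: "1 \<le> N"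
    and cyc: "cyclic N p" "cyclic N p'" "cyclic N u" "cyclic N y" "cyclic N c"
    and first: "\<And>r. u r + y r = (\<Sum>d=1..N. p (int d) * u (r + int d))
      + (\<Sum>d=1..N. p' (int d) * y (r + int d)) - b * p (- r) + h"
    and second: "\<And>r. u r + u (- r) = V + c r + (if int N dvd r then 2 * b else 0)"
    and diag: "y 0 = 0"
    and ne: "\<And>k. 1 \<le> k \<Longrightarrow> k < N \<Longrightarrow> fourier N p' k \<noteq> 1"
    and comm: "\<And>k. 1 \<le> k \<Longrightarrow> k < N \<Longrightarrow>
      (1 - fourier N p k) * (1 - cnj (fourier N p' k)) = (1 - cnj (fourier N p k)) * (1 - fourier N p' k)"
  shows "complex_of_real (\<Sum>d=1..N. y (int d)) =
    of_real b * (\<Sum>l=1..<N. 1 / (1 - fourier N p' l)) +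
    (\<Sum>l=1..<N. (1 - fourier N p l) / (1 - fourier N p' l) * (fourier N c l / 2))"
proof -
  define \<rho> where "\<rho> k = (1 - fourier N p k) / (1 - fourier N p' k)" for k
  define \<tau> where "\<tau> k = 1 / (1 - fourier N p' k)" for k
  have conv: "(\<Sum>r=1..N. of_real (\<Sum>d=1..N. q (int d) * f (int r + int d)) * character N k (int r)) =
      cnj (fourier N q k) * fourier N f k" if f: "cyclic N f" for q f k
  proof -
    have "(\<Sum>r=1..N. of_real (\<Sum>d=1..N. q (int d) * f (int r + int d)) * character N k (int r)) =
        (\<Sum>d=1..N. of_real (q (int d)) * (\<Sum>r=1..N. of_real (f (int r + int d)) * character N k (int r)))"
      by (simp add: sum_distrib_left sum_distrib_right mult_ac) (rule sum.swap)
    also have "\<dots> = cnj (fourier N q k) * fourier N f k"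
      unfolding fourier_shift[OF N f] fourier_def[of N q] cnj_sum sum_distrib_right
      by (intro sum.cong) (simp_all add: mult_ac)
    finally show ?thesis .
  qed
  have first_hat: "fourier N u k * (1 - cnj (fourier N p k)) + fourier N y k * (1 - cnj (fourier N p' k)) =
      - of_real b * cnj (fourier N p k)" if k: "1 \<le> k" "k < N" for k
  proof -
    have "fourier N u k + fourier N y k = (\<Sum>r=1..N. of_real (u (int r) + y (int r)) * character N k (int r))"
      by (simp add: fourier_def sum.distrib ring_distribs)
    also have "\<dots> = cnj (fourier N p k) * fourier N u k + cnj (fourier N p' k) * fourier N y k
        - of_real b * cnj (fourier N p k) + of_real h * (\<Sum>r=1..N. character N k (int r))"
      unfolding first of_real_add of_real_diff ring_distribs sum.distrib sum_subtractf
        conv[OF cyc(3)] conv[OF cyc(4)] of_real_mult[of b] mult.assoc sum_distrib_left[symmetric]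
        fourier_reflect[OF N cyc(1)]
      by simp
    finally show ?thesis
      unfolding sum_character_eq_0[OF k] by (simp add: algebra_simps)
  qed
  have second_hat: "fourier N u k + cnj (fourier N u k) = fourier N c k + 2 * of_real b"
    if k: "1 \<le> k" "k < N" for k
  proof -
    have "fourier N u k + cnj (fourier N u k) =
        (\<Sum>r=1..N. of_real (u (int r) + u (- int r)) * character N k (int r))"
      unfolding fourier_reflect[OF N cyc(3), symmetric] by (simp add: fourier_def sum.distrib ring_distribs)
    also have "\<dots> = of_real V * (\<Sum>r=1..N. character N k (int r)) + fourier N c k +
        (\<Sum>r=1..N. if r = N then 2 * of_real b else 0)"
    proof -
      have "of_real (if int N dvd int r then 2 * b else 0) * character N k (int r) =
          (if r = N then 2 * of_real b else 0)" if "r \<in> {1..N}" for r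
        using that character_multiple[OF N, of k 1] by (auto dest: dvd_imp_le)
      then have "(\<Sum>r=1..N. of_real (if int N dvd int r then 2 * b else 0) * character N k (int r)) =
          (\<Sum>r=1..N. if r = N then 2 * of_real b else 0)"
        by (intro sum.cong) auto
      then show ?thesis
        unfolding second of_real_add ring_distribs sum.distrib fourier_def sum_distrib_left[symmetric] by simp
    qed
    finally show ?thesis
      unfolding sum_character_eq_0[OF k] using N by simp
  qed
  have y_hat: "fourier N y k + cnj (fourier N y k) = - \<rho> k * fourier N c k - of_real b * (\<tau> k + cnj (\<tau> k))"
    if k: "1 \<le> k" "k < N" for k
  proof -
    have nz: "1 - fourier N p' k \<noteq> 0"
      using ne[OF k] by simp
    then have "cnj (1 - fourier N p' k) \<noteq> 0"
      by (simp only: complex_cnj_zero_iff) simp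
    then have nz': "1 - cnj (fourier N p' k) \<noteq> 0"
      by simp
    have \<rho>_real: "cnj (\<rho> k) = \<rho> k"
      using comm[OF k] unfolding \<rho>_def complex_cnj_divide complex_cnj_diff complex_cnj_one
        frac_eq_eq[OF nz' nz] by simp
    have "cnj (fourier N p k) = 1 - cnj (\<rho> k) * (1 - cnj (fourier N p' k))"
      using nz' by (simp add: \<rho>_def)
    then have mu: "cnj (fourier N p k) = 1 - \<rho> k * (1 - cnj (fourier N p' k))"
      by (simp only: \<rho>_real)
    have "(fourier N y k + \<rho> k * fourier N u k + of_real b * (cnj (\<tau> k) - \<rho> k)) * (1 - cnj (fourier N p' k)) = 0"
    proof -
      have "cnj (\<tau> k) * (1 - cnj (fourier N p' k)) = 1"
        using nz' by (simp add: \<tau>_def)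
      moreover have "(y0 + r * u0 + b0 * (t - r)) * s = y0 * s + u0 * (r * s) + b0 * (t * s - r * s)"
        for y0 r u0 b0 t s :: complex
        by (simp add: algebra_simps)
      ultimately show ?thesis
        using first_hat[OF k] unfolding mu by (simp add: eq_neg_iff_add_eq_0 add_ac)
    qed
    then have "fourier N y k + \<rho> k * fourier N u k + of_real b * (cnj (\<tau> k) - \<rho> k) = 0"
      using nz' by simp
    then have 1: "fourier N y k = - \<rho> k * fourier N u k - of_real b * (cnj (\<tau> k) - \<rho> k)"
      by (simp add: eq_neg_iff_add_eq_0 algebra_simps)
    from arg_cong[OF this, of cnj]
    have 2: "cnj (fourier N y k) = - \<rho> k * cnj (fourier N u k) - of_real b * (\<tau> k - \<rho> k)"
      by (simp add: \<rho>_real)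
    have "fourier N y k + cnj (fourier N y k) =
        - \<rho> k * (fourier N u k + cnj (fourier N u k)) - of_real b * (\<tau> k + cnj (\<tau> k) - 2 * \<rho> k)"
      unfolding 2 unfolding 1 by (simp add: algebra_simps)
    then show ?thesis
      unfolding second_hat[OF k] by (simp add: algebra_simps)
  qed
  have split: "(\<Sum>k=1..N. f k) = (\<Sum>k=1..<N. f k) + f N" for f :: "nat \<Rightarrow> complex"
    using N by (simp add: sum.last_plus add.commute)
  have "(\<Sum>k=1..N. fourier N y k) = 0"
    using sum_fourier[OF N cyc(4)] diag by simp
  then have "0 = (\<Sum>k=1..N. fourier N y k) + cnj (\<Sum>k=1..N. fourier N y k)"
    by simp
  also have "\<dots> = (\<Sum>k=1..<N. fourier N y k + cnj (fourier N y k)) + 2 * of_real (\<Sum>d=1..N. y (int d))"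
    unfolding split by (simp add: sum.distrib fourier_full[OF N])
  also have "(\<Sum>k=1..<N. fourier N y k + cnj (fourier N y k)) =
      (\<Sum>k=1..<N. - \<rho> k * fourier N c k - of_real b * (\<tau> k + cnj (\<tau> k)))"
    by (intro sum.cong refl y_hat) auto
  also have "\<dots> = - (\<Sum>k=1..<N. \<rho> k * fourier N c k) - of_real b * ((\<Sum>k=1..<N. \<tau> k) + (\<Sum>k=1..<N. cnj (\<tau> k)))"
    by (simp add: sum_subtractf sum_negf sum.distrib flip: sum_distrib_left)
  also have "(\<Sum>k=1..<N. cnj (\<tau> k)) = (\<Sum>k=1..<N. \<tau> (N - k))"
    using N by (intro sum.cong) (auto simp: \<tau>_def fourier_complement)
  also have "\<dots> = (\<Sum>k=1..<N. \<tau> k)"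
    by (rule sum_reflect_index)
  finally have "2 * of_real (\<Sum>d=1..N. y (int d)) =
      (\<Sum>k=1..<N. \<rho> k * fourier N c k) + 2 * (of_real b * (\<Sum>k=1..<N. \<tau> k))"
    by (simp add: algebra_simps)
  moreover have "(\<Sum>k=1..<N. \<rho> k * fourier N c k) = 2 * (\<Sum>k=1..<N. \<rho> k * (fourier N c k / 2))"
    by (simp add: sum_distrib_left)
  ultimately have "2 * of_real (\<Sum>d=1..N. y (int d)) =
      2 * (of_real b * (\<Sum>k=1..<N. \<tau> k) + (\<Sum>k=1..<N. \<rho> k * (fourier N c k / 2)))"
    by (simp only: distrib_left add.commute)
  then have "of_real (\<Sum>d=1..N. y (int d)) =
      of_real b * (\<Sum>k=1..<N. \<tau> k) + (\<Sum>k=1..<N. \<rho> k * (fourier N c k / 2))"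
    by (rule mult_left_cancel[THEN iffD1, rotated]) simp
  then show ?thesis
    unfolding \<rho>_def \<tau>_def .
qed

text \<open>Here \<open>U\<close> and \<open>Y\<close> stand for the sums of \<open>u\<close> and \<open>y\<close>, \<open>T\<close> and \<open>Z\<close> for the two sums over
  frequencies, \<open>G\<close> and \<open>g\<close> for the sum and the last of the mixed second moments. With
  \<open>\<delta> = 1 - n * A\<close>, the assumptions give \<open>\<delta> * U\<close> and \<open>\<delta> * u\<^sub>0\<close> as polynomials in the given data. The
  denominators \<open>\<delta> + n * A'\<close> come from \<open>\<beta> * (\<delta> + n * A') = n * A'\<close>, the balance of busy and idle
  steps.\<close>

lemma closed_form_of_means:
  fixes n A A' \<beta> \<beta>a T Z G g U Y u\<^sub>0 :: complex
  assumes n: "n \<noteq> 0" and D: "1 - n * A \<noteq> 0" and D': "1 - n * A + n * A' \<noteq> 0"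
    and \<beta>a: "\<beta>a = \<beta> * A + (1 - \<beta>) * A'"
    and \<beta>: "\<beta> = n * \<beta>a"
    and Y: "Y = \<beta> * T + n * ((n * g - G) / 2 - Z)"
    and U: "2 * U = n * (2 * A * (U - \<beta>) + 2 * A' * Y) + n * G + 2 * \<beta>"
    and u\<^sub>0: "2 * u\<^sub>0 = 2 * A * (U - \<beta>) + 2 * A' * Y + n * g + 2 * \<beta>"
  shows "1 - \<beta> = (1 - n * A) / (1 - n * A + n * A')"
    and "u\<^sub>0 = n * \<beta>a + n * A' * \<beta>a / (1 - n * A) * T
      + (1 - n * A + n * A') / (1 - n * A) * (n / 2) * g
      + (n * A - n * A') / (1 - n * A) * (1 / 2) * G
      - n * A' / (1 - n * A) * Z"
    and "(U + Y) / n = \<beta>a + A' / (1 - n * A) * T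
      + (1 - n * A + n * A') / (1 - n * A) * (n / 2) * g
      + (n * A - n * A') / (1 - n * A) * (1 / 2) * G
      - (1 - n * A + n * A') / (1 - n * A) * Z"
proof -
  define \<delta> where "\<delta> = 1 - n * A"
  have A: "n * A = 1 - \<delta>" by (simp add: \<delta>_def)
  have half: "x = z" if "2 * x = 2 * z" for x z :: complex
    using that by simp
  have \<delta>0: "\<delta> \<noteq> 0" using D by (simp add: \<delta>_def)
  have split: "(\<delta> * x + a * t + c * v * w + d * y * z - e * q) / \<delta> =
      x + a / \<delta> * t + c / \<delta> * v * w + d / \<delta> * y * z - e / \<delta> * q" for x a t c v w d y z e q
    using \<delta>0 by (simp add: add_divide_distrib diff_divide_distrib)
  have prob: "\<beta> * (\<delta> + n * A') = n * A'"
  proof -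
    have "\<beta> * (\<delta> + n * A') - n * A' = \<beta> - n * (\<beta> * A + (1 - \<beta>) * A')"
      by (simp add: \<delta>_def algebra_simps)
    also have "\<dots> = 0"
      using \<beta> unfolding \<beta>a by (simp only: right_minus_eq)
    finally show ?thesis by (simp only: right_minus_eq)
  qed
  show "1 - \<beta> = (1 - n * A) / (1 - n * A + n * A')"
    using prob D' by (simp add: \<delta>_def field_simps)
  have dU: "\<delta> * U = n * A' * Y + n * G / 2 + \<beta> * \<delta>"
  proof -
    have "2 * (\<delta> * U) = 2 * (n * A' * Y + n * G / 2 + \<beta> * \<delta>)"
      using U unfolding \<delta>_def by (simp add: algebra_simps)
    then show ?thesis by (rule half)
  qed
  have "\<delta> * u\<^sub>0 = A' * Y + n * A * G / 2 + \<delta> * (n * g / 2) + \<beta> * \<delta>"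
  proof -
    have "2 * (\<delta> * u\<^sub>0) = \<delta> * (2 * u\<^sub>0)" by simp
    also have "\<dots> = 2 * A * (\<delta> * U - \<delta> * \<beta>) + 2 * A' * \<delta> * Y + \<delta> * n * g + 2 * \<beta> * \<delta>"
      unfolding u\<^sub>0 by (simp add: algebra_simps)
    also have "\<dots> = 2 * (A' * Y * (n * A + \<delta>) + n * A * G / 2 + \<delta> * (n * g / 2) + \<beta> * \<delta>)"
      unfolding dU by (simp add: algebra_simps)
    finally have "\<delta> * u\<^sub>0 = A' * Y * (n * A + \<delta>) + n * A * G / 2 + \<delta> * (n * g / 2) + \<beta> * \<delta>"
      by (rule half)
    then show ?thesis by (simp add: A)
  qed
  also have "\<dots> = \<delta> * \<beta> + A' * \<beta> * T + (\<delta> + n * A') * (n / 2) * g + (n * A - n * A') * (1 / 2) * G - n * A' * Z"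
    unfolding Y by (simp add: algebra_simps add_divide_distrib diff_divide_distrib)
  finally have "u\<^sub>0 = (\<delta> * \<beta> + A' * \<beta> * T + (\<delta> + n * A') * (n / 2) * g + (n * A - n * A') * (1 / 2) * G - n * A' * Z) / \<delta>"
    using \<delta>0 by (metis nonzero_mult_div_cancel_left)
  also have "\<dots> = \<beta> + A' * \<beta> / \<delta> * T + (\<delta> + n * A') / \<delta> * (n / 2) * g + (n * A - n * A') / \<delta> * (1 / 2) * G - n * A' / \<delta> * Z"
    by (rule split)
  finally show "u\<^sub>0 = n * \<beta>a + n * A' * \<beta>a / (1 - n * A) * T
      + (1 - n * A + n * A') / (1 - n * A) * (n / 2) * g
      + (n * A - n * A') / (1 - n * A) * (1 / 2) * G
      - n * A' / (1 - n * A) * Z"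
    unfolding \<delta>_def \<beta> by (simp add: mult_ac)
  have "\<delta> * (U + Y) = Y * (\<delta> + n * A') + n * G / 2 + \<beta> * \<delta>"
    unfolding distrib_left dU by (simp add: algebra_simps)
  also have "Y * (\<delta> + n * A') = \<beta> * (\<delta> + n * A') * T + n * ((n * g - G) / 2 - Z) * (\<delta> + n * A')"
    unfolding Y by (simp add: algebra_simps add_divide_distrib diff_divide_distrib)
  also have "\<beta> * (\<delta> + n * A') * T + n * ((n * g - G) / 2 - Z) * (\<delta> + n * A') + n * G / 2 + \<beta> * \<delta> =
      n * (\<delta> * \<beta>a + A' * T + (\<delta> + n * A') * (n / 2) * g + (1 - \<delta> - n * A') * (1 / 2) * G - (\<delta> + n * A') * Z)"
    unfolding prob unfolding \<beta> by (simp add: algebra_simps add_divide_distrib diff_divide_distrib)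
  finally have "(U + Y) / n =
      (\<delta> * \<beta>a + A' * T + (\<delta> + n * A') * (n / 2) * g + (n * A - n * A') * (1 / 2) * G - (\<delta> + n * A') * Z) / \<delta>"
    using \<delta>0 n unfolding A by (simp add: divide_eq_eq eq_divide_eq mult_ac)
  also have "\<dots> = \<beta>a + A' / \<delta> * T + (\<delta> + n * A') / \<delta> * (n / 2) * g + (n * A - n * A') / \<delta> * (1 / 2) * G
      - (\<delta> + n * A') / \<delta> * Z"
    by (rule split)
  finally show "(U + Y) / n = \<beta>a + A' / (1 - n * A) * T
      + (1 - n * A + n * A') / (1 - n * A) * (n / 2) * g
      + (n * A - n * A') / (1 - n * A) * (1 / 2) * G
      - (1 - n * A + n * A') / (1 - n * A) * Z"
    unfolding \<delta>_def .
qed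

section \<open>Rotationally symmetric steps\<close>

text \<open>Station \<open>k\<close> becomes station \<open>k + s\<close>. The value off \<open>{1..N}\<close> is set to 0 so that the result lies
  in \<open>queue_space N\<close>.\<close>

definition rotate_queue :: "nat \<Rightarrow> nat \<Rightarrow> (nat \<Rightarrow> nat) \<Rightarrow> nat \<Rightarrow> nat" where
  "rotate_queue N s x = (\<lambda>k. if k \<in> {1..N} then x (stn N (int k - int s)) else 0)"

definition rotate_state :: "nat \<Rightarrow> nat \<Rightarrow> state \<Rightarrow> state" where
  "rotate_state N s = (\<lambda>(i, x). (stn N (int i + int s), rotate_queue N s x))"

lemma rotate_queue_in_queue_space: "rotate_queue N s x \<in> queue_space N"
  by (simp add: rotate_queue_def queue_space_def)

lemma rotate_queue_add: "rotate_queue N s (\<lambda>k. x k + y k) = (\<lambda>k. rotate_queue N s x k + rotate_queue N s y k)"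
  by (auto simp: rotate_queue_def)

lemma rotate_queue_at:
  assumes "1 \<le> N"
  shows "rotate_queue N s x (stn N (c + int s)) = x (stn N c)"
  using stn_in[OF assms, of "c + int s"] by (simp add: rotate_queue_def stn_diff_left[OF assms])

text \<open>One step from station \<open>i\<close> with queues \<open>v\<close> from which the served customer has already been
  removed. Busy and idle steps both have this form, with different parameters.\<close>

definition step_law ::
  "nat \<Rightarrow> (nat \<Rightarrow> nat \<Rightarrow> real) \<Rightarrow> (nat \<Rightarrow> nat \<Rightarrow> (nat \<Rightarrow> nat) pmf) \<Rightarrow> nat \<Rightarrow> (nat \<Rightarrow> nat) \<Rightarrow> state pmf" where
  "step_law N P B i v = bind_pmf (route N P i) (\<lambda>j. map_pmf (\<lambda>b. (j, \<lambda>k. v k + b k)) (B i j))"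

lemma polling_kernel_eq:
  "polling_kernel N P P' B B' (i, x) =
    (if 0 < x i then step_law N P B i (\<lambda>k. x k - of_bool (k = i)) else step_law N P' B' i x)"
  by (simp add: polling_kernel_def step_law_def)

text \<open>One of the two regimes, busy or idle. By rotational symmetry, the law of the displacement of the
  server and the law of the arrivals given the displacement are the same at all stations, hence
  can be read off at station \<open>N\<close>: the displacement is \<open>d\<close> with probability \<open>p d\<close>, and then
  \<open>B N d\<close> is the law of the arrivals.\<close>

locale rotational_steps =
  fixes N :: nat and P :: "nat \<Rightarrow> nat \<Rightarrow> real" and B :: "nat \<Rightarrow> nat \<Rightarrow> (nat \<Rightarrow> nat) pmf"
    and p :: "nat \<Rightarrow> real" and a :: "nat \<Rightarrow> (nat \<Rightarrow> real) \<Rightarrow> real"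
  assumes N: "1 \<le> N"
    and stoch: "stochastic N P"
    and arr: "arrival_laws N B"
    and rot: "rot_symmetric N P B p a"
begin

abbreviation D :: "nat \<Rightarrow> (nat \<Rightarrow> nat) pmf" where
  "D d \<equiv> B N d"

lemma N_in: "N \<in> {1..N}"
  using N by simp

lemma P_eq: "i \<in> {1..N} \<Longrightarrow> j \<in> {1..N} \<Longrightarrow> P i j = p (stn N (int j - int i))"
  using rot by (simp add: rot_symmetric_def)

lemma stn_minus_N: "d \<in> {1..N} \<Longrightarrow> stn N (int d - int N) = d"
proof -
  assume d: "d \<in> {1..N}"
  have "stn N (int d - int N) = stn N (int d)"
    using N by (simp add: stn_eq_iff)
  then show ?thesis using d by (simp add: stn_id)
qed

lemma p_eq: "d \<in> {1..N} \<Longrightarrow> p d = P N d"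
  using P_eq[OF N_in, of d] stn_minus_N by simp

lemma p_nonneg: "d \<in> {1..N} \<Longrightarrow> 0 \<le> p d"
  using stoch N_in by (simp add: p_eq stochastic_def)

lemma p_sum: "(\<Sum>d=1..N. p d) = 1"
proof -
  have "(\<Sum>d=1..N. p d) = (\<Sum>d=1..N. P N d)"
    by (intro sum.cong refl p_eq)
  then show ?thesis using stoch N_in by (simp add: stochastic_def)
qed

lemma B_support: "i \<in> {1..N} \<Longrightarrow> j \<in> {1..N} \<Longrightarrow> set_pmf (B i j) \<subseteq> queue_space N"
  using arr by (simp add: arrival_laws_def)

lemma gen_fun_B: "i \<in> {1..N} \<Longrightarrow> j \<in> {1..N} \<Longrightarrow> z \<in> unit_cube N \<Longrightarrow>
    gen_fun N (B i j) z = a (stn N (int j - int i)) z"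
  using rot by (simp add: rot_symmetric_def)

lemma gen_fun_D: "d \<in> {1..N} \<Longrightarrow> z \<in> unit_cube N \<Longrightarrow> gen_fun N (D d) z = a d z"
  using gen_fun_B[OF N_in, of d z] stn_minus_N by simp

lemma B_eq_D:
  assumes "i \<in> {1..N}" "j \<in> {1..N}"
  shows "B i j = D (stn N (int j - int i))"
  using assms
  by (intro pmf_eq_if_gen_fun_eq[where N = N] B_support N_in stn_in N)
    (simp_all add: gen_fun_B gen_fun_D stn_in[OF N] del: atLeastAtMost_iff One_nat_def)

text \<open>A rotation of the arrivals amounts to a rotation of the variables of the generating function,
  under which \<open>a d\<close> is invariant.\<close>

lemma rotate_D:
  assumes s: "s \<in> {1..N}" and d: "d \<in> {1..N}"
  shows "map_pmf (rotate_queue N s) (D d) = D d"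
proof (rule pmf_eq_if_gen_fun_eq[where N = N])
  show "set_pmf (map_pmf (rotate_queue N s) (D d)) \<subseteq> queue_space N"
    by (auto simp: rotate_queue_in_queue_space)
  show "set_pmf (D d) \<subseteq> queue_space N"
    by (rule B_support[OF N_in d])
  fix z assume z: "z \<in> unit_cube N"
  have z': "(\<lambda>k. z (stn N (int k + int s))) \<in> unit_cube N"
    using z stn_in[OF N] by (auto simp: unit_cube_def simp del: atLeastAtMost_iff One_nat_def)
  have "(\<Prod>k=1..N. z k ^ rotate_queue N s b k) = (\<Prod>k=1..N. z (stn N (int k + int s)) ^ b k)" for b
  proof -
    have "(\<Prod>k=1..N. z k ^ rotate_queue N s b k) =
        (\<Prod>k=1..N. z (stn N (int s + int k)) ^ rotate_queue N s b (stn N (int s + int k)))"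
      by (rule prod.reindex_bij_betw[OF bij_betw_stn_shift[OF N], symmetric])
    also have "\<dots> = (\<Prod>k=1..N. z (stn N (int k + int s)) ^ b k)"
      using N by (intro prod.cong) (simp_all add: add.commute[of "int s"] rotate_queue_at stn_id)
    finally show ?thesis .
  qed
  then have "gen_fun N (map_pmf (rotate_queue N s) (D d)) z = gen_fun N (D d) (\<lambda>k. z (stn N (int k + int s)))"
    by (simp add: gen_fun_def)
  also have "\<dots> = a d (\<lambda>k. z (stn N (int k + int s)))"
    by (rule gen_fun_D[OF d z'])
  also have "\<dots> = a d z"
    using rot s d z by (simp add: rot_symmetric_def)
  also have "\<dots> = gen_fun N (D d) z"
    by (rule gen_fun_D[OF d z, symmetric])
  finally show "gen_fun N (map_pmf (rotate_queue N s) (D d)) z = gen_fun N (D d) z" .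
qed

lemma pmf_route:
  assumes "i \<in> {1..N}"
  shows "pmf (route N P i) j = (if j \<in> {1..N} then P i j else 0)"
  unfolding route_def
proof (rule pmf_embed_pmf)
  show nonneg: "0 \<le> (if j \<in> {1..N} then P i j else 0)" for j
    using stoch assms by (auto simp: stochastic_def)
  have "(\<integral>\<^sup>+ j. ennreal (if j \<in> {1..N} then P i j else 0) \<partial>count_space UNIV) = (\<Sum>j=1..N. ennreal (P i j))"
    by (subst nn_integral_count_space'[where A = "{1..N}"]) auto
  also have "\<dots> = ennreal (\<Sum>j=1..N. P i j)"
    using stoch assms by (subst sum_ennreal) (auto simp: stochastic_def)
  finally show "(\<integral>\<^sup>+ j. ennreal (if j \<in> {1..N} then P i j else 0) \<partial>count_space UNIV) = 1"
    using stoch assms by (simp add: stochastic_def)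
qed

lemma set_route: "i \<in> {1..N} \<Longrightarrow> set_pmf (route N P i) \<subseteq> {1..N}"
  by (auto simp: set_pmf_iff pmf_route split: if_splits)

lemma route_rotate:
  assumes i: "i \<in> {1..N}"
  shows "route N P (stn N (int i + int s)) = map_pmf (\<lambda>j. stn N (int j + int s)) (route N P i)"
proof (rule pmf_eqI)
  fix k
  have i': "stn N (int i + int s) \<in> {1..N}" by (rule stn_in[OF N])
  show "pmf (route N P (stn N (int i + int s))) k = pmf (map_pmf (\<lambda>j. stn N (int j + int s)) (route N P i)) k"
  proof (cases "k \<in> {1..N}")
    case True
    define j where "j = stn N (int k - int s)"
    have j: "j \<in> {1..N}" unfolding j_def by (rule stn_in[OF N])
    have k: "stn N (int j + int s) = k"
      using True N by (simp add: j_def stn_simps)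
    have "pmf (map_pmf (\<lambda>j. stn N (int j + int s)) (route N P i)) k =
        measure_pmf.prob (route N P i) ((\<lambda>j. stn N (int j + int s)) -` {k})"
      by (simp add: pmf_map)
    also have "\<dots> = measure_pmf.prob (route N P i) {j}"
    proof (intro measure_pmf.finite_measure_eq_AE AE_pmfI)
      fix l assume "l \<in> set_pmf (route N P i)"
      then have l: "l \<in> {1..N}" using set_route[OF i] by auto
      have "l = j" if "stn N (int l + int s) = k"
        using arg_cong[OF that, of "\<lambda>k. stn N (int k - int s)"] N l
        by (simp add: j_def stn_simps)
      then show "l \<in> (\<lambda>j. stn N (int j + int s)) -` {k} \<longleftrightarrow> l \<in> {j}"
        using k by auto
    qed auto
    also have "\<dots> = P i j"
      using i j by (simp add: measure_pmf_single pmf_route)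
    also have "\<dots> = P (stn N (int i + int s)) k"
      unfolding P_eq[OF i j] P_eq[OF i' True] unfolding j_def stn_diff_left[OF N] stn_diff_right[OF N]
      by (simp add: algebra_simps)
    finally show ?thesis
      using True i' by (simp add: pmf_route)
  next
    case False
    then have "k \<notin> (\<lambda>j. stn N (int j + int s)) ` set_pmf (route N P i)"
      using stn_in[OF N] by auto
    then show ?thesis
      using False i' by (simp add: pmf_route pmf_eq_0_set_pmf del: atLeastAtMost_iff One_nat_def)
  qed
qed

lemma step_law_rotate:
  assumes i: "i \<in> {1..N}" and s: "s \<in> {1..N}"
  shows "step_law N P B (stn N (int i + int s)) (rotate_queue N s v) = map_pmf (rotate_state N s) (step_law N P B i v)"
proof -
  have "map_pmf (\<lambda>b. (stn N (int j + int s), \<lambda>k. rotate_queue N s v k + b k)) (B (stn N (int i + int s)) (stn N (int j + int s))) =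
      map_pmf (\<lambda>b. rotate_state N s (j, \<lambda>k. v k + b k)) (B i j)"
    if "j \<in> set_pmf (route N P i)" for j
  proof -
    have j: "j \<in> {1..N}" using that set_route[OF i] by auto
    have d: "stn N (int j - int i) \<in> {1..N}" by (rule stn_in[OF N])
    have "B (stn N (int i + int s)) (stn N (int j + int s)) = D (stn N (int j - int i))"
      using N by (subst B_eq_D) (simp_all add: stn_in stn_simps del: atLeastAtMost_iff One_nat_def)
    also have "\<dots> = map_pmf (rotate_queue N s) (B i j)"
      by (simp only: rotate_D[OF s d] B_eq_D[OF i j])
    finally show ?thesis
      by (simp add: map_pmf_comp rotate_state_def rotate_queue_add)
  qed
  then show ?thesis
    unfolding step_law_def route_rotate[OF i] bind_map_pmf map_bind_pmf
    by (intro bind_pmf_cong refl) (simp add: map_pmf_comp comp_def)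
qed

lemma step_law_expectation:
  fixes f :: "state \<Rightarrow> real"
  assumes i: "i \<in> {1..N}" and nonneg: "\<And>s. 0 \<le> f s"
    and int: "\<And>d. d \<in> {1..N} \<Longrightarrow> integrable (measure_pmf (D d)) (\<lambda>b. f (stn N (int i + int d), \<lambda>k. v k + b k))"
  shows "integrable (measure_pmf (step_law N P B i v)) f"
    and "measure_pmf.expectation (step_law N P B i v) f =
      (\<Sum>d=1..N. p d * measure_pmf.expectation (D d) (\<lambda>b. f (stn N (int i + int d), \<lambda>k. v k + b k)))"
proof -
  define G where "G j = map_pmf (\<lambda>b. (j, \<lambda>k. v k + b k)) (B i j)" for j
  have B_i: "B i (stn N (int i + int d)) = D d" if "d \<in> {1..N}" for d
    using N i that by (subst B_eq_D) (simp_all add: stn_in stn_simps del: atLeastAtMost_iff One_nat_def)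
  have inner: "integrable (measure_pmf (G j)) f" if "j \<in> {1..N}" for j
  proof -
    define d where "d = stn N (int j - int i)"
    have "d \<in> {1..N}" "stn N (int i + int d) = j"
      using N that by (simp_all add: d_def stn_in stn_simps del: atLeastAtMost_iff One_nat_def)
    then show ?thesis
      using int[of d] B_i[of d] by (simp add: G_def)
  qed
  have fin: "finite (set_pmf (route N P i))"
    using set_route[OF i] by (rule finite_subset) simp
  show "integrable (measure_pmf (step_law N P B i v)) f"
    unfolding step_law_def G_def[symmetric]
    using set_route[OF i] fin
    by (intro integrable_bind_nonneg nonneg inner integrable_measure_pmf_finite) auto
  have "measure_pmf.expectation (step_law N P B i v) f =
      measure_pmf.expectation (route N P i) (\<lambda>j. measure_pmf.expectation (G j) f)"
    unfolding step_law_def G_def[symmetric]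
    using set_route[OF i] by (intro expectation_bind_nonneg nonneg inner) auto
  also have "\<dots> = (\<Sum>j=1..N. pmf (route N P i) j * measure_pmf.expectation (G j) f)"
    using set_route[OF i] by (subst integral_measure_pmf[of "{1..N}"]) auto
  also have "\<dots> = (\<Sum>d=1..N. pmf (route N P i) (stn N (int i + int d)) * measure_pmf.expectation (G (stn N (int i + int d))) f)"
    by (rule sum_stn_shift[OF N, symmetric])
  also have "\<dots> = (\<Sum>d=1..N. p d * measure_pmf.expectation (D d) (\<lambda>b. f (stn N (int i + int d), \<lambda>k. v k + b k)))"
  proof (intro sum.cong refl)
    fix d assume d: "d \<in> {1..N}"
    have "pmf (route N P i) (stn N (int i + int d)) = p d"
      using N i d by (simp add: pmf_route P_eq stn_in stn_simps del: atLeastAtMost_iff One_nat_def)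
    then show "pmf (route N P i) (stn N (int i + int d)) * measure_pmf.expectation (G (stn N (int i + int d))) f =
        p d * measure_pmf.expectation (D d) (\<lambda>b. f (stn N (int i + int d), \<lambda>k. v k + b k))"
      using B_i[OF d] by (simp add: G_def)
  qed
  finally show "measure_pmf.expectation (step_law N P B i v) f =
      (\<Sum>d=1..N. p d * measure_pmf.expectation (D d) (\<lambda>b. f (stn N (int i + int d), \<lambda>k. v k + b k)))" .
qed

end

context rotational_steps
begin

lemma integrable_D_square: "d \<in> {1..N} \<Longrightarrow> k \<in> {1..N} \<Longrightarrow> integrable (measure_pmf (D d)) (\<lambda>b. (real (b k))\<^sup>2)"
  using arr N_in by (simp add: arrival_laws_def)

lemma integrable_D: "d \<in> {1..N} \<Longrightarrow> k \<in> {1..N} \<Longrightarrow> integrable (measure_pmf (D d)) (\<lambda>b. real (b k))"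
  by (rule integrable_of_square) (rule integrable_D_square)

lemma integrable_D_mult: "d \<in> {1..N} \<Longrightarrow> k \<in> {1..N} \<Longrightarrow> l \<in> {1..N} \<Longrightarrow>
    integrable (measure_pmf (D d)) (\<lambda>b. real (b k) * real (b l))"
  by (rule integrable_mult_of_squares) (rule integrable_D_square, assumption+)+

text \<open>The mean number of arrivals in one step at station \<open>N\<close>, and below the mean product of the
  arrivals at two stations at distance \<open>e\<close>. By rotation invariance station \<open>N\<close> may be replaced by
  any other (\<open>alpha_at\<close>, \<open>corr_at\<close>).\<close>

definition alpha :: real where
  "alpha = (\<Sum>d=1..N. p d * measure_pmf.expectation (D d) (\<lambda>b. real (b N)))"

definition corr :: "int \<Rightarrow> real" where
  "corr e = (\<Sum>d=1..N. p d * measure_pmf.expectation (D d) (\<lambda>b. real (b N) * real (b (stn N (int N + e)))))"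

lemma expectation_D_rotate:
  fixes F :: "(nat \<Rightarrow> nat) \<Rightarrow> real"
  assumes "s \<in> {1..N}" "d \<in> {1..N}"
  shows "measure_pmf.expectation (D d) F = measure_pmf.expectation (D d) (\<lambda>b. F (rotate_queue N s b))"
  using integral_map_pmf[of "rotate_queue N s" "D d" F] rotate_D[OF assms] by simp

text \<open>The rotation by \<open>N - k\<close> carries station \<open>k\<close> to station \<open>N\<close>, and so moments at \<open>k\<close> to moments
  at \<open>N\<close>.\<close>

lemma rotate_from_N:
  assumes "k \<in> {1..N}"
  shows "rotate_queue N (stn N (int N - int k)) b (stn N (int N + e)) = b (stn N (int k + e))"
proof -
  have "stn N (int k + e + int (stn N (int N - int k))) = stn N (int N + e)"
    unfolding stn_add_right[OF N] by (simp add: add.commute)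
  then show ?thesis
    using rotate_queue_at[OF N, of "stn N (int N - int k)" b "int k + e"] by simp
qed

lemma rotate_from_N_at: "k \<in> {1..N} \<Longrightarrow> rotate_queue N (stn N (int N - int k)) b N = b k"
  using rotate_from_N[of k b 0] by (simp add: stn_id N_in del: atLeastAtMost_iff One_nat_def)

lemma mean_D_at:
  assumes "k \<in> {1..N}" "d \<in> {1..N}"
  shows "measure_pmf.expectation (D d) (\<lambda>b. real (b k)) = measure_pmf.expectation (D d) (\<lambda>b. real (b N))"
  using expectation_D_rotate[OF stn_in[OF N, of "int N - int k"] assms(2), of "\<lambda>b. real (b N)"]
  by (simp only: rotate_from_N_at[OF assms(1)])

lemma alpha_at:
  assumes "k \<in> {1..N}"
  shows "(\<Sum>d=1..N. p d * measure_pmf.expectation (D d) (\<lambda>b. real (b k))) = alpha"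
  unfolding alpha_def by (intro sum.cong refl) (simp only: mean_D_at[OF assms])

lemma corr_at:
  assumes "k \<in> {1..N}"
  shows "(\<Sum>d=1..N. p d * measure_pmf.expectation (D d) (\<lambda>b. real (b k) * real (b (stn N (int k + e))))) = corr e"
  unfolding corr_def
proof (intro sum.cong refl)
  fix d assume d: "d \<in> {1..N}"
  show "p d * measure_pmf.expectation (D d) (\<lambda>b. real (b k) * real (b (stn N (int k + e)))) =
      p d * measure_pmf.expectation (D d) (\<lambda>b. real (b N) * real (b (stn N (int N + e))))"
    using expectation_D_rotate[OF stn_in[OF N, of "int N - int k"] d, of "\<lambda>b. real (b N) * real (b (stn N (int N + e)))"]
    by (simp only: rotate_from_N[OF assms] rotate_from_N_at[OF assms])
qed

lemma step_position:
  fixes r :: int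
  assumes i: "i \<in> {1..N}"
  defines "f \<equiv> \<lambda>s::state. real (snd s (stn N (int (fst s) + r)))"
  shows "integrable (measure_pmf (step_law N P B i v)) f"
    and "measure_pmf.expectation (step_law N P B i v) f = (\<Sum>d=1..N. p d * real (v (stn N (int i + (r + int d))))) + alpha"
proof -
  have st: "stn N (int (stn N (int i + int d)) + r) = stn N (int i + (r + int d))" for d
    unfolding stn_add_left[OF N] by (simp add: add_ac)
  have int: "integrable (measure_pmf (D d)) (\<lambda>b. real (b (stn N k)))" if "d \<in> {1..N}" for d k
    by (rule integrable_D[OF that stn_in[OF N]])
  show "integrable (measure_pmf (step_law N P B i v)) f"
    by (rule step_law_expectation(1)[OF i]) (use int in \<open>auto simp: f_def st\<close>)
  have "measure_pmf.expectation (step_law N P B i v) f =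
      (\<Sum>d=1..N. p d * measure_pmf.expectation (D d) (\<lambda>b. real (v (stn N (int i + (r + int d)))) + real (b (stn N (int i + (r + int d))))))"
    by (subst step_law_expectation(2)[OF i]) (use int in \<open>auto simp: f_def st\<close>)
  also have "\<dots> = (\<Sum>d=1..N. p d * real (v (stn N (int i + (r + int d))))) +
      (\<Sum>d=1..N. p d * measure_pmf.expectation (D d) (\<lambda>b. real (b (stn N (int i + (r + int d))))))"
    using int by (simp add: distrib_left sum.distrib)
  also have "(\<Sum>d=1..N. p d * measure_pmf.expectation (D d) (\<lambda>b. real (b (stn N (int i + (r + int d)))))) =
      (\<Sum>d=1..N. p d * measure_pmf.expectation (D d) (\<lambda>b. real (b N)))"
    by (intro sum.cong refl) (simp only: mean_D_at[OF stn_in[OF N]])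
  finally show "measure_pmf.expectation (step_law N P B i v) f =
      (\<Sum>d=1..N. p d * real (v (stn N (int i + (r + int d))))) + alpha"
    by (simp add: alpha_def)
qed

lemma step_total:
  assumes i: "i \<in> {1..N}"
  defines "f \<equiv> \<lambda>s::state. \<Sum>k=1..N. real (snd s k)"
  shows "integrable (measure_pmf (step_law N P B i v)) f"
    and "measure_pmf.expectation (step_law N P B i v) f = (\<Sum>k=1..N. real (v k)) + real N * alpha"
proof -
  have nonneg: "0 \<le> f s" for s by (simp add: f_def sum_nonneg)
  have int: "integrable (measure_pmf (D d)) (\<lambda>b. f (stn N (int i + int d), \<lambda>k. v k + b k))" if "d \<in> {1..N}" for d
    unfolding f_def using that by (auto intro!: Bochner_Integration.integrable_sum integrable_D simp del: One_nat_def)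
  show "integrable (measure_pmf (step_law N P B i v)) f"
    by (rule step_law_expectation(1)[OF i nonneg int])
  have "measure_pmf.expectation (step_law N P B i v) f =
      (\<Sum>d=1..N. p d * measure_pmf.expectation (D d) (\<lambda>b. f (stn N (int i + int d), \<lambda>k. v k + b k)))"
    by (rule step_law_expectation(2)[OF i nonneg int])
  also have "\<dots> = (\<Sum>d=1..N. p d * (\<Sum>k=1..N. real (v k) + measure_pmf.expectation (D d) (\<lambda>b. real (b k))))"
  proof (intro sum.cong refl arg_cong2[where f = "(*)"])
    fix d assume "d \<in> {1..N}"
    then show "measure_pmf.expectation (D d) (\<lambda>b. f (stn N (int i + int d), \<lambda>k. v k + b k)) =
        (\<Sum>k=1..N. real (v k) + measure_pmf.expectation (D d) (\<lambda>b. real (b k)))"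
      unfolding f_def using integrable_D by (simp add: Bochner_Integration.integral_sum del: One_nat_def)
  qed
  also have "\<dots> = (\<Sum>k=1..N. (\<Sum>d=1..N. p d) * real (v k) + (\<Sum>d=1..N. p d * measure_pmf.expectation (D d) (\<lambda>b. real (b k))))"
    unfolding sum_distrib_left sum_distrib_right distrib_left sum.distrib
    by (subst (1 2) sum.swap) simp
  also have "\<dots> = (\<Sum>k=1..N. real (v k) + alpha)"
    by (intro sum.cong refl) (simp only: p_sum alpha_at mult_1)
  finally show "measure_pmf.expectation (step_law N P B i v) f = (\<Sum>k=1..N. real (v k)) + real N * alpha"
    by (simp add: sum.distrib)
qed

lemma step_corr:
  fixes e :: int
  assumes i: "i \<in> {1..N}"
  defines "f \<equiv> \<lambda>s::state. \<Sum>k=1..N. real (snd s k) * real (snd s (stn N (int k + e)))"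
  shows "integrable (measure_pmf (step_law N P B i v)) f"
    and "measure_pmf.expectation (step_law N P B i v) f =
      (\<Sum>k=1..N. real (v k) * real (v (stn N (int k + e)))) + 2 * alpha * (\<Sum>k=1..N. real (v k)) + real N * corr e"
proof -
  have nonneg: "0 \<le> f s" for s by (simp add: f_def sum_nonneg)
  define m1 where "m1 d k = measure_pmf.expectation (D d) (\<lambda>b. real (b k))" for d k
  define m2 where "m2 d k = measure_pmf.expectation (D d) (\<lambda>b. real (b k) * real (b (stn N (int k + e))))" for d k
  have expand: "f (stn N (int i + int d), \<lambda>k. v k + b k) =
      (\<Sum>k=1..N. real (v k) * real (v (stn N (int k + e))) + (real (v k) * real (b (stn N (int k + e)))
        + (real (v (stn N (int k + e))) * real (b k) + real (b k) * real (b (stn N (int k + e))))))" for d b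
    unfolding f_def by (intro sum.cong refl) (simp add: algebra_simps)
  have int1: "integrable (measure_pmf (D d)) (\<lambda>b. c * real (b k))" if "d \<in> {1..N}" "k \<in> {1..N}" for d k c
    using integrable_D[OF that] by simp
  have int2: "integrable (measure_pmf (D d)) (\<lambda>b. real (b k) * real (b (stn N l)))" if "d \<in> {1..N}" "k \<in> {1..N}" for d k l
    by (rule integrable_D_mult[OF that stn_in[OF N]])
  have int: "integrable (measure_pmf (D d)) (\<lambda>b. f (stn N (int i + int d), \<lambda>k. v k + b k))" if "d \<in> {1..N}" for d
    unfolding expand
    by (intro Bochner_Integration.integrable_sum Bochner_Integration.integrable_add int1 int2 that stn_in N) auto
  show "integrable (measure_pmf (step_law N P B i v)) f"
    by (rule step_law_expectation(1)[OF i nonneg int])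
  have "measure_pmf.expectation (step_law N P B i v) f =
      (\<Sum>d=1..N. p d * measure_pmf.expectation (D d) (\<lambda>b. f (stn N (int i + int d), \<lambda>k. v k + b k)))"
    by (rule step_law_expectation(2)[OF i nonneg int])
  also have "\<dots> = (\<Sum>d=1..N. p d * (\<Sum>k=1..N. real (v k) * real (v (stn N (int k + e))) + (real (v k) * m1 d (stn N (int k + e))
        + (real (v (stn N (int k + e))) * m1 d k + m2 d k))))"
  proof (intro sum.cong refl arg_cong2[where f = "(*)"])
    fix d assume d: "d \<in> {1..N}"
    show "measure_pmf.expectation (D d) (\<lambda>b. f (stn N (int i + int d), \<lambda>k. v k + b k)) =
        (\<Sum>k=1..N. real (v k) * real (v (stn N (int k + e))) + (real (v k) * m1 d (stn N (int k + e))
        + (real (v (stn N (int k + e))) * m1 d k + m2 d k)))"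
      unfolding expand m1_def m2_def
      apply (subst Bochner_Integration.integral_sum)
      subgoal by (intro Bochner_Integration.integrable_add int1 int2 d stn_in N) auto
      apply (intro sum.cong refl)
      apply (subst Bochner_Integration.integral_add, simp, intro Bochner_Integration.integrable_add int1 int2 d stn_in N, assumption, assumption)
      apply (subst Bochner_Integration.integral_add, intro int1 d stn_in N, intro Bochner_Integration.integrable_add int1 int2 d stn_in N, assumption, assumption)
      apply (subst Bochner_Integration.integral_add, intro int1 d, assumption, intro int2 d, assumption)
      apply simp
      done
  qed
  also have "\<dots> = (\<Sum>k=1..N. \<Sum>d=1..N. p d * (real (v k) * real (v (stn N (int k + e))) + (real (v k) * m1 d (stn N (int k + e))
        + (real (v (stn N (int k + e))) * m1 d k + m2 d k))))"
    unfolding sum_distrib_left by (rule sum.swap)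
  also have "\<dots> = (\<Sum>k=1..N. real (v k) * real (v (stn N (int k + e))) + (alpha * real (v k)
        + (alpha * real (v (stn N (int k + e))) + corr e)))"
  proof (intro sum.cong refl)
    fix k assume k: "k \<in> {1..N}"
    have "(\<Sum>d=1..N. p d * (x + (y * m1 d (stn N (int k + e)) + (z * m1 d k + m2 d k)))) =
        (\<Sum>d=1..N. p d) * x + (y * (\<Sum>d=1..N. p d * m1 d (stn N (int k + e))) + (z * (\<Sum>d=1..N. p d * m1 d k) + (\<Sum>d=1..N. p d * m2 d k)))" for x y z
      by (simp add: distrib_left sum.distrib sum_distrib_left sum_distrib_right mult_ac)
    then show "(\<Sum>d=1..N. p d * (real (v k) * real (v (stn N (int k + e))) + (real (v k) * m1 d (stn N (int k + e))
        + (real (v (stn N (int k + e))) * m1 d k + m2 d k)))) =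
      real (v k) * real (v (stn N (int k + e))) + (alpha * real (v k) + (alpha * real (v (stn N (int k + e))) + corr e))"
      unfolding m1_def m2_def p_sum alpha_at[OF k] alpha_at[OF stn_in[OF N]] corr_at[OF k] by (simp add: mult.commute)
  qed
  also have "\<dots> = (\<Sum>k=1..N. real (v k) * real (v (stn N (int k + e)))) + (alpha * (\<Sum>k=1..N. real (v k))
      + (alpha * (\<Sum>k=1..N. real (v (stn N (int k + e)))) + real N * corr e))"
    by (simp add: sum.distrib sum_distrib_left)
  also have "(\<Sum>k=1..N. real (v (stn N (int k + e)))) = (\<Sum>k=1..N. real (v k))"
    using sum_stn_shift[OF N, of "\<lambda>k. real (v k)" e] by (simp add: add.commute)
  finally show "measure_pmf.expectation (step_law N P B i v) f =
      (\<Sum>k=1..N. real (v k) * real (v (stn N (int k + e)))) + 2 * alpha * (\<Sum>k=1..N. real (v k)) + real N * corr e"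
    by simp
qed

end

section \<open>Partial derivatives as moments\<close>

context rotational_steps
begin

lemma mu_full:
  assumes "z \<in> unit_cube N"
  shows "mu N p a N z = of_real (\<Sum>d=1..N. p d * gen_fun N (D d) z)"
proof -
  have "omega N N ^ d = 1" for d
    using N by (simp add: omega_power character_full)
  then have "mu N p a N z = (\<Sum>d=1..N. of_real (p d * a d z))"
    by (simp add: mu_def)
  also have "\<dots> = (\<Sum>d=1..N. of_real (p d * gen_fun N (D d) z))"
    using assms by (intro sum.cong refl) (simp add: gen_fun_D)
  finally show ?thesis by simp
qed

lemma mu_ones: "mu N p a k ones = fourier N (\<lambda>r. p (stn N r)) k"
  unfolding mu_def fourier_def
proof (intro sum.cong refl)
  fix d assume d: "d \<in> {1..N}"
  have "a d ones = gen_fun N (D d) ones"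
    using gen_fun_D[OF d, of ones] by (simp add: unit_cube_def)
  also have "\<dots> = 1"
    by (simp add: gen_fun_def)
  finally show "of_real (p d) * of_real (a d ones) * omega N k ^ d = of_real (p (stn N (int d))) * character N k (int d)"
    using d by (simp add: omega_power stn_id)
qed

lemma vector_derivative_of_power_moments:
  fixes w :: "nat \<Rightarrow> (nat \<Rightarrow> nat) \<Rightarrow> real" and g :: "(nat \<Rightarrow> nat) \<Rightarrow> nat"
  assumes f: "\<And>t. t \<in> {0..1} \<Longrightarrow> f t = complex_of_real (\<Sum>d=1..N. p d * measure_pmf.expectation (D d) (\<lambda>b. w d b * t ^ g b))"
    and w: "\<And>d. d \<in> {1..N} \<Longrightarrow> integrable (measure_pmf (D d)) (w d)"
    and wg: "\<And>d. d \<in> {1..N} \<Longrightarrow> integrable (measure_pmf (D d)) (\<lambda>b. w d b * real (g b))"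
    and s: "s \<in> {0..1}"
  shows "vector_derivative f (at s within {0..1}) =
    of_real (\<Sum>d=1..N. p d * measure_pmf.expectation (D d) (\<lambda>b. w d b * (real (g b) * s ^ (g b - 1))))"
proof -
  have "((\<lambda>t. \<Sum>d=1..N. p d * measure_pmf.expectation (D d) (\<lambda>b. w d b * t ^ g b)) has_real_derivative
      (\<Sum>d=1..N. p d * measure_pmf.expectation (D d) (\<lambda>b. w d b * (real (g b) * s ^ (g b - 1))))) (at s within {0..1})"
    by (intro DERIV_sum DERIV_cmult expectation_power_derivative w wg s)
  then have "((\<lambda>t. complex_of_real (\<Sum>d=1..N. p d * measure_pmf.expectation (D d) (\<lambda>b. w d b * t ^ g b))) has_vector_derivative
      of_real (\<Sum>d=1..N. p d * measure_pmf.expectation (D d) (\<lambda>b. w d b * (real (g b) * s ^ (g b - 1))))) (at s within {0..1})"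
    by (intro bounded_linear.has_vector_derivative[OF bounded_linear_of_real])
      (simp add: has_real_derivative_iff_has_vector_derivative)
  then have "(f has_vector_derivative
      of_real (\<Sum>d=1..N. p d * measure_pmf.expectation (D d) (\<lambda>b. w d b * (real (g b) * s ^ (g b - 1))))) (at s within {0..1})"
    by (rule has_vector_derivative_transform[OF s f, rotated])
  then show ?thesis
    by (intro vector_derivative_within_closed_interval s) auto
qed

text \<open>The derivative is needed on the whole edge of the cube through the corner, since the second
  derivative differentiates along it.\<close>

lemma partial_deriv_mu:
  assumes z: "z \<in> unit_cube N" and r: "r \<in> {1..N}"
  shows "partial_deriv r (mu N p a N) z = of_real (\<Sum>d=1..N. p d *
    measure_pmf.expectation (D d) (\<lambda>b. (\<Prod>k\<in>{1..N}-{r}. z k ^ b k) * (real (b r) * z r ^ (b r - 1))))"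
  unfolding partial_deriv_def
proof (rule vector_derivative_of_power_moments)
  fix t :: real assume t: "t \<in> {0..1}"
  have "(\<Prod>k=1..N. (z(r := t)) k ^ b k) = (\<Prod>k\<in>{1..N}-{r}. z k ^ b k) * t ^ b r" for b
    by (subst prod.remove[OF _ r]) (auto intro!: prod.cong)
  moreover have "z(r := t) \<in> unit_cube N"
    using z t by (auto simp: unit_cube_def)
  ultimately show "mu N p a N (z(r := t)) =
      of_real (\<Sum>d=1..N. p d * measure_pmf.expectation (D d) (\<lambda>b. (\<Prod>k\<in>{1..N}-{r}. z k ^ b k) * t ^ b r))"
    by (simp add: mu_full gen_fun_def)
next
  have bound: "0 \<le> (\<Prod>k\<in>{1..N}-{r}. z k ^ b k)" "(\<Prod>k\<in>{1..N}-{r}. z k ^ b k) \<le> 1" for b :: "nat \<Rightarrow> nat"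
    using z by (auto simp: unit_cube_def intro!: prod_nonneg prod_le_1 power_le_one)
  show "integrable (measure_pmf (D d)) (\<lambda>b. \<Prod>k\<in>{1..N}-{r}. z k ^ b k)" for d
    by (rule measure_pmf.integrable_const_bound[where B = 1]) (auto simp: bound simp del: One_nat_def intro!: AE_I2)
  show "integrable (measure_pmf (D d)) (\<lambda>b. (\<Prod>k\<in>{1..N}-{r}. z k ^ b k) * real (b r))" if "d \<in> {1..N}" for d
    by (rule Bochner_Integration.integrable_bound[OF integrable_D[OF that r]])
      (auto simp: abs_mult bound simp del: One_nat_def intro!: AE_I2 mult_left_le_one_le)
  show "z r \<in> {0..1}"
    using z r by (auto simp: unit_cube_def)
qed

lemma alpha1_eq:
  assumes "r \<in> {1..N}"
  shows "alpha1 N p a r = of_real alpha"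
  unfolding alpha1_def alpha_at[OF assms, symmetric]
  by (subst partial_deriv_mu[OF _ assms]) (simp_all add: unit_cube_def)

text \<open>For \<open>d\<close> divisible by \<open>N\<close> both derivatives are taken in the same variable and give the factorial
  moment, which is \<open>corr\<close> minus the mean.\<close>

lemma alpha2_eq:
  assumes q: "q \<in> {1..N}"
  shows "alpha2 N p a q d = of_real (corr (int d) - of_bool (N dvd d) * alpha)"
proof -
  define k where "k = stn N (int q + int d)"
  have k: "k \<in> {1..N}" unfolding k_def by (rule stn_in[OF N])
  have kq: "k = q \<longleftrightarrow> N dvd d"
  proof -
    have "k = q \<longleftrightarrow> stn N (int q + int d) = stn N (int q)"
      using stn_id[OF q] by (simp add: k_def)
    also have "\<dots> \<longleftrightarrow> int N dvd int d"
      by (simp add: stn_eq_iff[OF N] mod_eq_dvd_iff)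
    finally show ?thesis by simp
  qed
  define g where "g b = (if k = q then b k - 1 else b q)" for b :: "nat \<Rightarrow> nat"
  have first: "partial_deriv k (mu N p a N) (ones(q := t)) =
      of_real (\<Sum>d=1..N. p d * measure_pmf.expectation (D d) (\<lambda>b. real (b k) * t ^ g b))" if "t \<in> {0..1}" for t
  proof -
    have "(\<Prod>l\<in>{1..N}-{k}. (ones(q := t)) l ^ b l) * (real (b k) * (ones(q := t)) k ^ (b k - 1)) = real (b k) * t ^ g b" for b
    proof (cases "k = q")
      case True
      then have "(\<Prod>l\<in>{1..N}-{k}. (ones(q := t)) l ^ b l) = 1"
        by (intro prod.neutral) auto
      then show ?thesis using True by (simp add: g_def)
    next
      case False
      then have "(\<Prod>l\<in>{1..N}-{k}. (ones(q := t)) l ^ b l) = t ^ b q * (\<Prod>l\<in>{1..N}-{k}-{q}. (ones(q := t)) l ^ b l)"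
        using q by (subst prod.remove[of _ q]) auto
      also have "(\<Prod>l\<in>{1..N}-{k}-{q}. (ones(q := t)) l ^ b l) = 1"
        by (intro prod.neutral) auto
      finally show ?thesis using False by (simp add: g_def)
    qed
    moreover have "ones(q := t) \<in> unit_cube N"
      using that by (auto simp: unit_cube_def)
    ultimately show ?thesis
      by (simp only: partial_deriv_mu[OF _ k])
  qed
  have kg: "real (b k) * real (g b) = real (b q) * real (b k) - of_bool (N dvd d) * real (b k)" for b
    by (cases "b k") (auto simp: g_def kq[symmetric] algebra_simps)
  have int_kg: "integrable (measure_pmf (D d')) (\<lambda>b. real (b k) * real (g b))" if "d' \<in> {1..N}" for d'
    unfolding kg using integrable_D_mult[OF that q k] integrable_D[OF that k] by simp
  have "alpha2 N p a q d = of_real (\<Sum>d=1..N. p d * measure_pmf.expectation (D d) (\<lambda>b. real (b k) * (real (g b) * 1 ^ (g b - 1))))"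
    unfolding alpha2_def k_def[symmetric] unfolding partial_deriv_def[of q]
    by (rule vector_derivative_of_power_moments) (use first int_kg k integrable_D in auto)
  also have "(\<Sum>d=1..N. p d * measure_pmf.expectation (D d) (\<lambda>b. real (b k) * (real (g b) * 1 ^ (g b - 1)))) =
      (\<Sum>d'=1..N. p d' * measure_pmf.expectation (D d') (\<lambda>b. real (b q) * real (b k))
        - of_bool (N dvd d) * (p d' * measure_pmf.expectation (D d') (\<lambda>b. real (b k))))"
  proof (intro sum.cong refl)
    fix d' assume d': "d' \<in> {1..N}"
    show "p d' * measure_pmf.expectation (D d') (\<lambda>b. real (b k) * (real (g b) * 1 ^ (g b - 1))) =
        p d' * measure_pmf.expectation (D d') (\<lambda>b. real (b q) * real (b k))
        - of_bool (N dvd d) * (p d' * measure_pmf.expectation (D d') (\<lambda>b. real (b k)))"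
      unfolding power_one mult_1_right kg
      using integrable_D_mult[OF d' q k] integrable_D[OF d' k] by (simp add: right_diff_distrib)
  qed
  also have "\<dots> = corr (int d) - of_bool (N dvd d) * alpha"
    unfolding sum_subtractf sum_distrib_left[symmetric] alpha_at[OF k]
    using corr_at[OF q, of "int d"] by (simp add: k_def)
  finally show ?thesis .
qed

end

section \<open>Balance equations of the stationary moments\<close>

text \<open>The polling chain with its stationary law: \<open>busy\<close> are the steps of a server that finds a
  customer, \<open>idle\<close> those of a server that does not.\<close>

locale stationary_polling =
  busy: rotational_steps N P B p a + idle: rotational_steps N P' B' p' a'
  for N P B p a P' B' p' a' +
  fixes \<pi> :: "state pmf"
  assumes irr: "irreducible_chain (state_space N) (polling_kernel N P P' B B')"
    and stat: "stationary_law (state_space N) (polling_kernel N P P' B B') \<pi>"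
    and second_moments: "\<And>k. k \<in> {1..N} \<Longrightarrow> integrable (measure_pmf \<pi>) (\<lambda>(i, x). (real (x k))\<^sup>2)"
begin

abbreviation K :: "state \<Rightarrow> state pmf" where
  "K \<equiv> polling_kernel N P P' B B'"

lemmas N = busy.N

definition found_busy :: "state \<Rightarrow> real" where
  "found_busy s = of_bool (0 < snd s (fst s))"

definition ahead :: "int \<Rightarrow> state \<Rightarrow> real" where
  "ahead r s = real (snd s (stn N (int (fst s) + r)))"

definition total :: "state \<Rightarrow> real" where
  "total s = (\<Sum>k=1..N. real (snd s k))"

definition prods :: "int \<Rightarrow> state \<Rightarrow> real" where
  "prods e s = (\<Sum>k=1..N. real (snd s k) * real (snd s (stn N (int k + e))))"

definition E :: "(state \<Rightarrow> real) \<Rightarrow> real" where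
  "E f = measure_pmf.expectation \<pi> f"

lemma support:
  assumes "s \<in> set_pmf \<pi>"
  shows "fst s \<in> {1..N}" "snd s \<in> queue_space N"
  using assms stat by (auto simp: stationary_law_def state_space_def)

lemma integrable_queue_square: "k \<in> {1..N} \<Longrightarrow> integrable (measure_pmf \<pi>) (\<lambda>s. (real (snd s k))\<^sup>2)"
  using second_moments[of k] by (simp add: case_prod_unfold)

lemma integrable_queue: "k \<in> {1..N} \<Longrightarrow> integrable (measure_pmf \<pi>) (\<lambda>s. real (snd s k))"
  by (rule integrable_of_square) (rule integrable_queue_square)

lemma integrable_total: "integrable (measure_pmf \<pi>) total"
  unfolding total_def[abs_def] by (intro Bochner_Integration.integrable_sum integrable_queue)

lemma integrable_prods: "integrable (measure_pmf \<pi>) (prods e)"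
  unfolding prods_def[abs_def]
  by (rule Bochner_Integration.integrable_sum, rule integrable_mult_of_squares)
    (rule integrable_queue_square, assumption, rule integrable_queue_square, rule stn_in[OF N])

lemma ahead_le_total: "\<bar>ahead r s\<bar> \<le> total s"
proof -
  have "real (snd s (stn N (int (fst s) + r))) \<le> (\<Sum>k=1..N. real (snd s k))"
    by (rule member_le_sum[OF stn_in[OF N]]) auto
  then show ?thesis by (simp add: ahead_def total_def)
qed

lemma found_busy_01: "found_busy s = 0 \<or> found_busy s = 1"
  by (auto simp: found_busy_def)

lemma integrable_found_busy_mult:
  assumes "integrable (measure_pmf \<pi>) f"
  shows "integrable (measure_pmf \<pi>) (\<lambda>s. found_busy s * f s)"
  by (rule Bochner_Integration.integrable_bound[OF assms]) (auto simp: found_busy_def intro!: AE_I2)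

lemma integrable_ahead: "integrable (measure_pmf \<pi>) (ahead r)"
  by (rule Bochner_Integration.integrable_bound[OF integrable_total])
    (auto intro!: AE_I2 order_trans[OF ahead_le_total])

lemma integrable_found_busy: "integrable (measure_pmf \<pi>) found_busy"
  using integrable_found_busy_mult[of "\<lambda>_. 1"] by simp

lemmas integrable = integrable_found_busy integrable_ahead integrable_total integrable_prods
  integrable_found_busy_mult[OF integrable_ahead] integrable_found_busy_mult[OF integrable_total]

lemma K_eq:
  "K s = (if found_busy s = 1 then step_law N P B (fst s) (\<lambda>k. snd s k - of_bool (k = fst s))
    else step_law N P' B' (fst s) (snd s))"
  using polling_kernel_eq[of N P P' B B' "fst s" "snd s"] by (simp add: found_busy_def)

lemma served:
  assumes "found_busy s = 1"
  shows "real (snd s k - of_bool (k = fst s)) = real (snd s k) - of_bool (k = fst s)"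
  using assms by (auto simp: found_busy_def)

lemma sum_ahead: "(\<Sum>d=1..N. ahead (int d) s) = total s"
  unfolding ahead_def total_def by (rule sum_stn_shift[OF N])

lemma sum_station_indicator:
  assumes "k \<in> {1..N}"
  shows "(\<Sum>j=1..N. f j * of_bool (j = k)) = (f k :: real)"
proof -
  have "(\<Sum>j=1..N. f j * of_bool (j = k)) = (\<Sum>j=1..N. if j = k then f j else 0)"
    by (intro sum.cong) auto
  then show ?thesis using assms by (simp only: sum.delta finite_atLeastAtMost if_True)
qed

text \<open>Stationarity in the form used below: \<open>g s\<close> is the mean of \<open>f\<close> after one step from \<open>s\<close>. Being
  nonnegative, \<open>f\<close> may be unbounded.\<close>

lemma balance:
  assumes "\<And>s. 0 \<le> f s" "\<And>s. s \<in> set_pmf \<pi> \<Longrightarrow> integrable (measure_pmf (K s)) f"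
    and "\<And>s. s \<in> set_pmf \<pi> \<Longrightarrow> measure_pmf.expectation (K s) f = g s"
  shows "E f = E g"
proof -
  have "E f = measure_pmf.expectation (bind_pmf \<pi> K) f"
    using stat by (simp add: E_def stationary_law_def)
  also have "\<dots> = measure_pmf.expectation \<pi> (\<lambda>s. measure_pmf.expectation (K s) f)"
    by (rule expectation_bind_nonneg[OF assms(1,2)])
  also have "\<dots> = E g"
    unfolding E_def using assms(3) by (intro integral_cong_AE) (auto simp: AE_measure_pmf_iff)
  finally show ?thesis .
qed

definition b :: real where "b = E found_busy"
definition u :: "int \<Rightarrow> real" where "u r = E (\<lambda>s. found_busy s * ahead r s)"
definition y :: "int \<Rightarrow> real" where "y r = E (\<lambda>s. (1 - found_busy s) * ahead r s)"

lemma E_const: "E (\<lambda>_. c) = c"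
  by (simp add: E_def)

lemma u_plus_y: "u r + y r = E (ahead r)"
  unfolding u_def y_def E_def using integrable
  by (subst Bochner_Integration.integral_add[symmetric]) (auto simp: left_diff_distrib)

text \<open>Seen from the server, every station is at exactly one of the distances \<open>1, \<dots>, N\<close>.\<close>

lemma sum_u: "(\<Sum>d=1..N. u (int d)) = E (\<lambda>s. found_busy s * total s)"
  unfolding u_def E_def sum_ahead[symmetric] sum_distrib_left
  by (subst Bochner_Integration.integral_sum) (auto intro: integrable)

lemma sum_y: "(\<Sum>d=1..N. y (int d)) = E (\<lambda>s. (1 - found_busy s) * total s)"
  unfolding y_def E_def sum_ahead[symmetric] sum_distrib_left
  by (subst Bochner_Integration.integral_sum) (auto simp: left_diff_distrib intro!: Bochner_Integration.integrable_diff integrable)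

text \<open>A server that finds no customer has an empty queue at distance 0.\<close>

lemma y_0: "y 0 = 0"
proof -
  have "(1 - found_busy s) * ahead 0 s = 0" if "s \<in> set_pmf \<pi>" for s
    using support(1)[OF that] by (auto simp: found_busy_def ahead_def stn_id simp del: atLeastAtMost_iff)
  then have "E (\<lambda>s. (1 - found_busy s) * ahead 0 s) = E (\<lambda>_. 0)"
    unfolding E_def by (intro integral_cong_AE) (auto simp: AE_measure_pmf_iff)
  then show ?thesis by (simp add: y_def E_const)
qed

lemma total_step:
  assumes s: "s \<in> set_pmf \<pi>"
  shows "integrable (measure_pmf (K s)) total"
    and "measure_pmf.expectation (K s) total =
      total s + found_busy s * (real N * busy.alpha - 1) + (1 - found_busy s) * (real N * idle.alpha)"
proof -
  note i = support(1)[OF s]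
  have tot: "total = (\<lambda>s. \<Sum>k=1..N. real (snd s k))"
    by (rule ext) (simp add: total_def)
  have "integrable (measure_pmf (K s)) total \<and> measure_pmf.expectation (K s) total =
      total s + found_busy s * (real N * busy.alpha - 1) + (1 - found_busy s) * (real N * idle.alpha)"
  proof (cases "found_busy s = 1")
    case True
    have "(\<Sum>k=1..N. real (snd s k - of_bool (k = fst s))) = total s - 1"
      using sum_station_indicator[OF i, of "\<lambda>_. 1"]
      by (simp add: served[OF True] sum_subtractf total_def)
    then show ?thesis
      using busy.step_total[OF i] True unfolding tot[symmetric] by (simp add: K_eq)
  next
    case False
    then have "found_busy s = 0" using found_busy_01[of s] by simp
    then show ?thesis
      using idle.step_total[OF i] unfolding tot[symmetric] by (simp add: K_eq total_def)
  qed
  then show "integrable (measure_pmf (K s)) total"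
    and "measure_pmf.expectation (K s) total =
      total s + found_busy s * (real N * busy.alpha - 1) + (1 - found_busy s) * (real N * idle.alpha)"
    by blast+
qed

text \<open>Each step adds \<open>N\<close> times the mean number of arrivals per station, and a busy step removes one
  customer.\<close>

lemma busy_probability: "b = real N * (b * busy.alpha + (1 - b) * idle.alpha)"
proof -
  have "E total = E (\<lambda>s. total s + found_busy s * (real N * busy.alpha - 1) + (1 - found_busy s) * (real N * idle.alpha))"
    by (rule balance[OF _ total_step]) (auto simp: total_def sum_nonneg)
  also have "\<dots> = E total + b * (real N * busy.alpha - 1) + (1 - b) * (real N * idle.alpha)"
    unfolding E_def b_def using integrable by simp
  finally show ?thesis by (simp add: algebra_simps)
qed

lemma ahead_step:
  assumes s: "s \<in> set_pmf \<pi>"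
  shows "integrable (measure_pmf (K s)) (ahead r)"
    and "measure_pmf.expectation (K s) (ahead r) =
      found_busy s * ((\<Sum>d=1..N. p d * ahead (r + int d) s) - p (stn N (- r)) + busy.alpha) +
      (1 - found_busy s) * ((\<Sum>d=1..N. p' d * ahead (r + int d) s) + idle.alpha)"
proof -
  note i = support(1)[OF s]
  have ahead: "ahead r = (\<lambda>s. real (snd s (stn N (int (fst s) + r))))" for r
    by (rule ext) (simp add: ahead_def)
  have "integrable (measure_pmf (K s)) (ahead r) \<and> measure_pmf.expectation (K s) (ahead r) =
      found_busy s * ((\<Sum>d=1..N. p d * ahead (r + int d) s) - p (stn N (- r)) + busy.alpha) +
      (1 - found_busy s) * ((\<Sum>d=1..N. p' d * ahead (r + int d) s) + idle.alpha)"
  proof (cases "found_busy s = 1")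
    case True
    have hit: "stn N (int (fst s) + (r + int d)) = fst s \<longleftrightarrow> d = stn N (- r)" if "d \<in> {1..N}" for d
    proof
      assume "stn N (int (fst s) + (r + int d)) = fst s"
      from arg_cong[OF this, of "\<lambda>k. stn N (int k + (- r - int (fst s)))"]
      have "stn N (int d) = stn N (- r)"
        unfolding stn_add_left[OF N] by simp
      then show "d = stn N (- r)" using that by (simp add: stn_id)
    next
      assume "d = stn N (- r)"
      then show "stn N (int (fst s) + (r + int d)) = fst s"
        using stn_add_right[OF N, of "int (fst s) + r" "- r"] stn_id[OF i] by (simp add: add.assoc)
    qed
    have "(\<Sum>d=1..N. p d * real (snd s (stn N (int (fst s) + (r + int d))) - of_bool (stn N (int (fst s) + (r + int d)) = fst s))) =
        (\<Sum>d=1..N. p d * ahead (r + int d) s - p d * of_bool (d = stn N (- r)))"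
    proof (intro sum.cong refl)
      fix d assume "d \<in> {1..N}"
      from hit[OF this]
      show "p d * real (snd s (stn N (int (fst s) + (r + int d))) - of_bool (stn N (int (fst s) + (r + int d)) = fst s)) =
          p d * ahead (r + int d) s - p d * of_bool (d = stn N (- r))"
        unfolding served[OF True] by (simp only: ahead right_diff_distrib)
    qed
    also have "\<dots> = (\<Sum>d=1..N. p d * ahead (r + int d) s) - p (stn N (- r))"
      unfolding sum_subtractf sum_station_indicator[OF stn_in[OF N]] ..
    finally have "(\<Sum>d=1..N. p d * real (snd s (stn N (int (fst s) + (r + int d))) - of_bool (stn N (int (fst s) + (r + int d)) = fst s))) =
        (\<Sum>d=1..N. p d * ahead (r + int d) s) - p (stn N (- r))" .
    then show ?thesis
      using busy.step_position[OF i] True unfolding ahead[symmetric] by (simp add: K_eq)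
  next
    case False
    then have "found_busy s = 0" using found_busy_01[of s] by simp
    then show ?thesis
      using idle.step_position[OF i] unfolding ahead[symmetric] by (simp add: K_eq ahead_def)
  qed
  then show "integrable (measure_pmf (K s)) (ahead r)"
    and "measure_pmf.expectation (K s) (ahead r) =
      found_busy s * ((\<Sum>d=1..N. p d * ahead (r + int d) s) - p (stn N (- r)) + busy.alpha) +
      (1 - found_busy s) * ((\<Sum>d=1..N. p' d * ahead (r + int d) s) + idle.alpha)"
    by blast+
qed

text \<open>After a displacement by \<open>d\<close>, the queue at distance \<open>r\<close> from the new position is the one at
  distance \<open>r + d\<close> from the old position; it has lost the served customer if \<open>d = - r\<close>.\<close>

lemma first_moments:
  "u r + y r = (\<Sum>d=1..N. p d * u (r + int d)) + (\<Sum>d=1..N. p' d * y (r + int d))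
    - b * p (stn N (- r)) + (b * busy.alpha + (1 - b) * idle.alpha)"
proof -
  have "E (ahead r) = E (\<lambda>s. found_busy s * ((\<Sum>d=1..N. p d * ahead (r + int d) s) - p (stn N (- r)) + busy.alpha) +
      (1 - found_busy s) * ((\<Sum>d=1..N. p' d * ahead (r + int d) s) + idle.alpha))"
    by (rule balance[OF _ ahead_step]) (auto simp: ahead_def)
  also have "\<dots> = E (\<lambda>s. (\<Sum>d=1..N. p d * (found_busy s * ahead (r + int d) s)) + (\<Sum>d=1..N. p' d * ((1 - found_busy s) * ahead (r + int d) s))
      + (found_busy s * (busy.alpha - p (stn N (- r))) + (1 - found_busy s) * idle.alpha))"
    unfolding E_def by (intro Bochner_Integration.integral_cong refl)
      (simp add: distrib_left right_diff_distrib left_diff_distrib sum_distrib_left sum_subtractf mult_ac)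
  also have "\<dots> = (\<Sum>d=1..N. p d * u (r + int d)) + (\<Sum>d=1..N. p' d * y (r + int d))
      + (b * (busy.alpha - p (stn N (- r))) + (1 - b) * idle.alpha)"
  proof -
    have "integrable (measure_pmf \<pi>) (\<lambda>s. (1 - found_busy s) * ahead k s)" for k
      by (auto simp: left_diff_distrib intro!: Bochner_Integration.integrable_diff integrable)
    then show ?thesis
      unfolding E_def u_def y_def b_def using integrable by simp
  qed
  finally show ?thesis
    unfolding u_plus_y by (simp add: algebra_simps)
qed

lemma prods_step:
  assumes s: "s \<in> set_pmf \<pi>"
  shows "integrable (measure_pmf (K s)) (prods e)"
    and "measure_pmf.expectation (K s) (prods e) = prods e s
      + found_busy s * (of_bool (int N dvd e) - ahead e s - ahead (- e) s + 2 * busy.alpha * (total s - 1) + real N * busy.corr e)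
      + (1 - found_busy s) * (2 * idle.alpha * total s + real N * idle.corr e)"
proof -
  note i = support(1)[OF s]
  have pr: "prods e = (\<lambda>s. \<Sum>k=1..N. real (snd s k) * real (snd s (stn N (int k + e))))"
    by (rule ext) (simp add: prods_def)
  have "integrable (measure_pmf (K s)) (prods e) \<and> measure_pmf.expectation (K s) (prods e) = prods e s
      + found_busy s * (of_bool (int N dvd e) - ahead e s - ahead (- e) s + 2 * busy.alpha * (total s - 1) + real N * busy.corr e)
      + (1 - found_busy s) * (2 * idle.alpha * total s + real N * idle.corr e)"
  proof (cases "found_busy s = 1")
    case True
    have tot: "(\<Sum>k=1..N. real (snd s k - of_bool (k = fst s))) = total s - 1"
      using sum_station_indicator[OF i, of "\<lambda>_. 1"]
      by (simp add: served[OF True] sum_subtractf total_def)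
    have hit: "stn N (int k + e) = fst s \<longleftrightarrow> k = stn N (int (fst s) - e)" if "k \<in> {1..N}" for k
    proof
      assume "stn N (int k + e) = fst s"
      then show "k = stn N (int (fst s) - e)"
        using stn_diff_left[OF N, of "int k + e" e] stn_id[OF that] by simp
    next
      assume "k = stn N (int (fst s) - e)"
      then show "stn N (int k + e) = fst s"
        using stn_add_left[OF N, of "int (fst s) - e" e] stn_id[OF i] by simp
    qed
    \<comment> \<open>The served station is its own partner only when \<open>e\<close> is divisible by \<open>N\<close>.\<close>
    have self: "stn N (int (fst s) + e) = fst s \<longleftrightarrow> int N dvd e"
      using stn_eq_iff[OF N, of "int (fst s) + e" "int (fst s)"] stn_id[OF i] by (simp add: mod_eq_dvd_iff)
    have "(\<Sum>k=1..N. real (snd s k - of_bool (k = fst s)) * real (snd s (stn N (int k + e)) - of_bool (stn N (int k + e) = fst s))) =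
        (\<Sum>k=1..N. real (snd s k) * real (snd s (stn N (int k + e))) - real (snd s k) * of_bool (k = stn N (int (fst s) - e))
          - (real (snd s (stn N (int k + e))) * of_bool (k = fst s) - of_bool (stn N (int k + e) = fst s) * of_bool (k = fst s)))"
    proof (intro sum.cong refl)
      fix k assume "k \<in> {1..N}"
      from hit[OF this]
      show "real (snd s k - of_bool (k = fst s)) * real (snd s (stn N (int k + e)) - of_bool (stn N (int k + e) = fst s)) =
        real (snd s k) * real (snd s (stn N (int k + e))) - real (snd s k) * of_bool (k = stn N (int (fst s) - e))
          - (real (snd s (stn N (int k + e))) * of_bool (k = fst s) - of_bool (stn N (int k + e) = fst s) * of_bool (k = fst s))"
        unfolding served[OF True] by (simp only: left_diff_distrib right_diff_distrib) (simp add: mult_ac)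
    qed
    also have "\<dots> = prods e s - ahead (- e) s - (ahead e s - of_bool (int N dvd e))"
      unfolding sum_subtractf sum_station_indicator[OF stn_in[OF N]] sum_station_indicator[OF i]
      by (simp add: prods_def ahead_def self)
    finally have "(\<Sum>k=1..N. real (snd s k - of_bool (k = fst s)) * real (snd s (stn N (int k + e)) - of_bool (stn N (int k + e) = fst s))) =
        prods e s - ahead (- e) s - (ahead e s - of_bool (int N dvd e))" .
    then show ?thesis
      using busy.step_corr[OF i, where e = e] tot True unfolding pr[symmetric] by (simp add: K_eq)
  next
    case False
    then have "found_busy s = 0" using found_busy_01[of s] by simp
    then show ?thesis
      using idle.step_corr[OF i, where e = e] unfolding pr[symmetric] by (simp add: K_eq total_def prods_def)
  qed
  then show "integrable (measure_pmf (K s)) (prods e)"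
    and "measure_pmf.expectation (K s) (prods e) = prods e s
      + found_busy s * (of_bool (int N dvd e) - ahead e s - ahead (- e) s + 2 * busy.alpha * (total s - 1) + real N * busy.corr e)
      + (1 - found_busy s) * (2 * idle.alpha * total s + real N * idle.corr e)"
    by blast+
qed

text \<open>The mean of \<open>prods e\<close> itself cancels. What remains of the served customer are the queues at the
  distances \<open>e\<close> and \<open>- e\<close> from the server, and the square of the removed customer when \<open>e\<close> is
  divisible by \<open>N\<close>.\<close>

lemma second_moments_balance:
  "u e + u (- e) = 2 * busy.alpha * ((\<Sum>d=1..N. u (int d)) - b) + 2 * idle.alpha * (\<Sum>d=1..N. y (int d))
    + real N * (b * busy.corr e + (1 - b) * idle.corr e) + (if int N dvd e then b else 0)"
proof -
  have "E (prods e) = E (\<lambda>s. prods e s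
      + found_busy s * (of_bool (int N dvd e) - ahead e s - ahead (- e) s + 2 * busy.alpha * (total s - 1) + real N * busy.corr e)
      + (1 - found_busy s) * (2 * idle.alpha * total s + real N * idle.corr e))"
    by (rule balance[OF _ prods_step]) (auto simp: prods_def sum_nonneg)
  also have "\<dots> = E (\<lambda>s. prods e s - found_busy s * ahead e s - found_busy s * ahead (- e) s
      + found_busy s * (of_bool (int N dvd e) - 2 * busy.alpha + real N * busy.corr e)
      + 2 * busy.alpha * (found_busy s * total s) + 2 * idle.alpha * ((1 - found_busy s) * total s) + (1 - found_busy s) * (real N * idle.corr e))"
    unfolding E_def by (intro Bochner_Integration.integral_cong refl) (simp add: algebra_simps)
  also have "\<dots> = E (prods e) - u e - u (- e) + b * (of_bool (int N dvd e) - 2 * busy.alpha + real N * busy.corr e)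
      + 2 * busy.alpha * (\<Sum>d=1..N. u (int d)) + 2 * idle.alpha * (\<Sum>d=1..N. y (int d)) + (1 - b) * (real N * idle.corr e)"
  proof -
    have "integrable (measure_pmf \<pi>) (\<lambda>s. (1 - found_busy s) * total s)"
      by (auto simp: left_diff_distrib intro!: Bochner_Integration.integrable_diff integrable)
    then show ?thesis
      unfolding sum_u sum_y unfolding E_def u_def b_def using integrable by simp
  qed
  finally show ?thesis by (simp add: algebra_simps split: if_splits)
qed

end

section \<open>Routing eigenvalues\<close>

lemma station_mat_product_entries:
  assumes eq: "(1\<^sub>m N - station_mat N P) * (1\<^sub>m N - transpose_mat (station_mat N P')) =
      (1\<^sub>m N - transpose_mat (station_mat N P)) * (1\<^sub>m N - station_mat N P')"
    and i: "i \<in> {1..N}" and j: "j \<in> {1..N}"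
  shows "(\<Sum>l=1..N. (of_bool (i = l) - P i l) * (of_bool (l = j) - P' j l)) =
    (\<Sum>l=1..N. (of_bool (i = l) - P l i) * (of_bool (l = j) - P' l j))"
proof -
  obtain i0 j0 where ij: "i = Suc i0" "j = Suc j0" "i0 < N" "j0 < N"
    using i j by (cases i; cases j) auto
  have "((1\<^sub>m N - station_mat N P) * (1\<^sub>m N - transpose_mat (station_mat N P'))) $$ (i0, j0) =
      (\<Sum>l<N. (of_bool (i = Suc l) - P i (Suc l)) * (of_bool (Suc l = j) - P' j (Suc l)))"
    using ij by (simp add: station_mat_def scalar_prod_def atLeast0LessThan) (intro sum.cong refl, auto)
  moreover have "((1\<^sub>m N - transpose_mat (station_mat N P)) * (1\<^sub>m N - station_mat N P')) $$ (i0, j0) =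
      (\<Sum>l<N. (of_bool (i = Suc l) - P (Suc l) i) * (of_bool (Suc l = j) - P' (Suc l) j))"
    using ij by (simp add: station_mat_def scalar_prod_def atLeast0LessThan) (intro sum.cong refl, auto)
  ultimately show ?thesis
    using eq by (simp add: sum.atLeast1_atMost_eq)
qed

context stationary_polling
begin

definition route_prob :: "int \<Rightarrow> real" where "route_prob r = p (stn N r)"
definition route_prob' :: "int \<Rightarrow> real" where "route_prob' r = p' (stn N r)"

lemma cyclic_route_prob: "cyclic N route_prob" "cyclic N route_prob'"
  using N by (simp_all add: cyclic_def route_prob_def route_prob'_def stn_stn)

text \<open>Both sides of the matrix identity are compared in row \<open>N\<close>, applied to the vector of the values of
  the character \<open>k\<close>. All factors are circulant, so this vector is a common eigenvector.\<close>

lemma routing_eigenvalues_commute: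
  assumes eq: "(1\<^sub>m N - station_mat N P) * (1\<^sub>m N - transpose_mat (station_mat N P')) =
      (1\<^sub>m N - transpose_mat (station_mat N P)) * (1\<^sub>m N - station_mat N P')"
  shows "(1 - fourier N route_prob k) * (1 - cnj (fourier N route_prob' k)) = (1 - cnj (fourier N route_prob k)) * (1 - fourier N route_prob' k)"
proof -
  have point: "(\<Sum>j=1..N. of_bool (l = j) * character N k (int j)) = character N k (int l)" if "l \<in> {1..N}" for l
  proof -
    have "(\<Sum>j=1..N. of_bool (l = j) * character N k (int j)) = (\<Sum>j=1..N. if l = j then character N k (int j) else 0)"
      by (intro sum.cong) auto
    then show ?thesis using that by (simp only: sum.delta' finite_atLeastAtMost if_True)
  qed
  have right: "(\<Sum>j=1..N. of_real (\<Sum>l=1..N. c l * e l j) * character N k (int j)) = z * (\<Sum>l=1..N. of_real (c l) * character N k (int l))"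
    if "\<And>l. l \<in> {1..N} \<Longrightarrow> (\<Sum>j=1..N. of_real (e l j) * character N k (int j)) = character N k (int l) * z"
    for c :: "nat \<Rightarrow> real" and e z
  proof -
    have "(\<Sum>j=1..N. of_real (\<Sum>l=1..N. c l * e l j) * character N k (int j)) =
        (\<Sum>l=1..N. of_real (c l) * (\<Sum>j=1..N. of_real (e l j) * character N k (int j)))"
      by (simp add: sum_distrib_left sum_distrib_right mult_ac) (rule sum.swap)
    also have "\<dots> = (\<Sum>l=1..N. of_real (c l) * (character N k (int l) * z))"
      by (intro sum.cong refl) (simp only: that)
    finally show ?thesis by (simp add: sum_distrib_left mult_ac)
  qed
  have of_real_bool: "complex_of_real (of_bool Q) = of_bool Q" for Q
    by (cases Q) auto
  have entry: "(\<Sum>j=1..N. of_real (of_bool (l = j) - q j) * character N k (int j)) = character N k (int l) * (1 - z)"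
    if "l \<in> {1..N}" "(\<Sum>j=1..N. of_real (q j) * character N k (int j)) = character N k (int l) * z" for l q z
    by (simp only: of_real_diff of_real_bool left_diff_distrib sum_subtractf right_diff_distrib point[OF that(1)] that(2) mult_1_right)
  have character_N: "character N k (int N) = 1"
    using character_multiple[OF N, of k 1] by simp
  have P: "P i j = route_prob (int j - int i)" "P' i j = route_prob' (int j - int i)" if "i \<in> {1..N}" "j \<in> {1..N}" for i j
    using that by (simp_all add: busy.P_eq idle.P_eq route_prob_def route_prob'_def)
  have lhs: "(\<Sum>j=1..N. of_real (\<Sum>l=1..N. (of_bool (N = l) - P N l) * (of_bool (l = j) - P' j l)) * character N k (int j)) =
      (1 - cnj (fourier N route_prob' k)) * (1 - fourier N route_prob k)"
  proof -
    have "(\<Sum>j=1..N. of_real (\<Sum>l=1..N. (of_bool (N = l) - P N l) * (of_bool (l = j) - P' j l)) * character N k (int j)) =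
        (1 - cnj (fourier N route_prob' k)) * (\<Sum>l=1..N. of_real (of_bool (N = l) - P N l) * character N k (int l))"
    proof (rule right)
      fix l assume l: "l \<in> {1..N}"
      have "(\<Sum>j=1..N. of_real (P' j l) * character N k (int j)) = (\<Sum>j=1..N. of_real (route_prob' (int l - int j)) * character N k (int j))"
        by (intro sum.cong refl) (simp only: P(2)[OF _ l])
      then show "(\<Sum>j=1..N. of_real (of_bool (l = j) - P' j l) * character N k (int j)) = character N k (int l) * (1 - cnj (fourier N route_prob' k))"
        by (intro entry[OF l]) (simp only: fourier_circulant_column[OF N cyclic_route_prob(2)])
    qed
    moreover have "(\<Sum>j=1..N. of_real (P N j) * character N k (int j)) = (\<Sum>j=1..N. of_real (route_prob (int j - int N)) * character N k (int j))"
      by (intro sum.cong refl) (simp only: P(1)[OF busy.N_in])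
    then have "(\<Sum>l=1..N. of_real (of_bool (N = l) - P N l) * character N k (int l)) = character N k (int N) * (1 - fourier N route_prob k)"
      by (intro entry[OF busy.N_in]) (simp only: fourier_circulant_row[OF N cyclic_route_prob(1)])
    ultimately show ?thesis by (simp only: character_N mult_1)
  qed
  have rhs: "(\<Sum>j=1..N. of_real (\<Sum>l=1..N. (of_bool (N = l) - P l N) * (of_bool (l = j) - P' l j)) * character N k (int j)) =
      (1 - fourier N route_prob' k) * (1 - cnj (fourier N route_prob k))"
  proof -
    have "(\<Sum>j=1..N. of_real (\<Sum>l=1..N. (of_bool (N = l) - P l N) * (of_bool (l = j) - P' l j)) * character N k (int j)) =
        (1 - fourier N route_prob' k) * (\<Sum>l=1..N. of_real (of_bool (N = l) - P l N) * character N k (int l))"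
    proof (rule right)
      fix l assume l: "l \<in> {1..N}"
      have "(\<Sum>j=1..N. of_real (P' l j) * character N k (int j)) = (\<Sum>j=1..N. of_real (route_prob' (int j - int l)) * character N k (int j))"
        by (intro sum.cong refl) (simp only: P(2)[OF l])
      then show "(\<Sum>j=1..N. of_real (of_bool (l = j) - P' l j) * character N k (int j)) = character N k (int l) * (1 - fourier N route_prob' k)"
        by (intro entry[OF l]) (simp only: fourier_circulant_row[OF N cyclic_route_prob(2)])
    qed
    moreover have "(\<Sum>j=1..N. of_real (P j N) * character N k (int j)) = (\<Sum>j=1..N. of_real (route_prob (int N - int j)) * character N k (int j))"
      by (intro sum.cong refl) (simp only: P(1)[OF _ busy.N_in])
    then have "(\<Sum>l=1..N. of_real (of_bool (N = l) - P l N) * character N k (int l)) = character N k (int N) * (1 - cnj (fourier N route_prob k))"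
      by (intro entry[OF busy.N_in]) (simp only: fourier_circulant_column[OF N cyclic_route_prob(1)])
    ultimately show ?thesis by (simp only: character_N mult_1)
  qed
  have "(\<Sum>j=1..N. of_real (\<Sum>l=1..N. (of_bool (N = l) - P N l) * (of_bool (l = j) - P' j l)) * character N k (int j)) =
      (\<Sum>j=1..N. of_real (\<Sum>l=1..N. (of_bool (N = l) - P l N) * (of_bool (l = j) - P' l j)) * character N k (int j))"
    by (intro sum.cong refl) (simp only: station_mat_product_entries[OF eq busy.N_in])
  then show ?thesis
    unfolding lhs rhs by (simp add: mult.commute)
qed

end

section \<open>Rotation invariance of the stationary law\<close>

context stationary_polling
begin

lemma rotate_served:
  assumes i: "i \<in> {1..N}"
  shows "rotate_queue N s (\<lambda>k. x k - of_bool (k = i)) = (\<lambda>k. rotate_queue N s x k - of_bool (k = stn N (int i + int s)))"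
proof
  fix k
  show "rotate_queue N s (\<lambda>k. x k - of_bool (k = i)) k = rotate_queue N s x k - of_bool (k = stn N (int i + int s))"
  proof (cases "k \<in> {1..N}")
    case True
    have "stn N (int k - int s) = i \<longleftrightarrow> k = stn N (int i + int s)"
      using stn_add_left[OF N, of "int k - int s" "int s"] stn_diff_left[OF N, of "int i + int s" "int s"]
        stn_id[OF i] stn_id[OF True] by auto
    then show ?thesis
      unfolding rotate_queue_def by (simp only: True if_True)
  next
    case False
    then show ?thesis
      unfolding rotate_queue_def by (simp only: if_False diff_0_eq_0)
  qed
qed

lemma K_rotate:
  assumes s: "fst s \<in> {1..N}" and k: "k \<in> {1..N}"
  shows "K (rotate_state N k s) = map_pmf (rotate_state N k) (K s)"
proof -
  obtain i x where s_eq: "s = (i, x)" by (cases s)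
  then have i: "i \<in> {1..N}" using s by simp
  have "rotate_queue N k x (stn N (int i + int k)) = x i"
    using rotate_queue_at[OF N, of k x "int i"] stn_id[OF i] by simp
  then show ?thesis
    using busy.step_law_rotate[OF i k, of "\<lambda>l. x l - of_bool (l = i)"] idle.step_law_rotate[OF i k, of x]
    by (simp add: s_eq rotate_state_def polling_kernel_eq rotate_served[OF i])
qed

text \<open>The rotated law is again stationary because rotations commute with the kernel.\<close>

lemma stationary_rotate:
  assumes k: "k \<in> {1..N}"
  shows "map_pmf (rotate_state N k) \<pi> = \<pi>"
proof (rule stationary_law_unique[OF irr _ stat])
  have "set_pmf (map_pmf (rotate_state N k) \<pi>) \<subseteq> state_space N"
    using stn_in[OF N] rotate_queue_in_queue_space
    by (auto simp: rotate_state_def state_space_def case_prod_beta simp del: atLeastAtMost_iff)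
  moreover have "bind_pmf (map_pmf (rotate_state N k) \<pi>) K = map_pmf (rotate_state N k) (bind_pmf \<pi> K)"
    unfolding bind_map_pmf map_bind_pmf
    by (intro bind_pmf_cong refl) (rule K_rotate[OF support(1) k])
  ultimately show "stationary_law (state_space N) K (map_pmf (rotate_state N k) \<pi>)"
    using stat by (simp add: stationary_law_def)
qed

lemma E_rotate:
  assumes "k \<in> {1..N}"
  shows "E f = E (\<lambda>s. f (rotate_state N k s))"
  using integral_map_pmf[of "rotate_state N k" \<pi> f] by (simp add: E_def stationary_rotate[OF assms])

text \<open>Rotations carry the event that the server is at one station to the same event at any other
  station, so all stations contribute equally to the mean of a rotation invariant function.\<close>

lemma E_at_station:
  assumes m: "m \<in> {1..N}"
    and inv: "\<And>k s. k \<in> {1..N} \<Longrightarrow> s \<in> set_pmf \<pi> \<Longrightarrow> h (rotate_state N k s) = h s"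
    and int: "integrable (measure_pmf \<pi>) h"
  shows "E (\<lambda>s. of_bool (fst s = m) * h s) = E h / real N"
proof -
  have eq: "E (\<lambda>s. of_bool (fst s = l) * h s) = E (\<lambda>s. of_bool (fst s = m) * h s)" if l: "l \<in> {1..N}" for l
  proof -
    define k where "k = stn N (int m - int l)"
    have k: "k \<in> {1..N}" unfolding k_def by (rule stn_in[OF N])
    have lk: "stn N (int l + int k) = m" "stn N (int m - int k) = l"
      unfolding k_def stn_add_right[OF N] stn_diff_right[OF N] by (simp_all add: stn_id[OF l] stn_id[OF m])
    have "E (\<lambda>s. of_bool (fst s = m) * h s) = E (\<lambda>s. of_bool (fst (rotate_state N k s) = m) * h (rotate_state N k s))"
      by (rule E_rotate[OF k])
    also have "\<dots> = E (\<lambda>s. of_bool (fst s = l) * h s)"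
      unfolding E_def
    proof (intro integral_cong_AE AE_pmfI)
      fix s assume s: "s \<in> set_pmf \<pi>"
      have "stn N (int (fst s) + int k) = m \<longleftrightarrow> fst s = l"
      proof
        assume "stn N (int (fst s) + int k) = m"
        then have "l = stn N (int (stn N (int (fst s) + int k)) - int k)"
          using lk(2) by simp
        also have "\<dots> = stn N (int (fst s))"
          unfolding stn_diff_left[OF N] by simp
        finally show "fst s = l"
          unfolding stn_id[OF support(1)[OF s]] by (rule sym)
      next
        assume "fst s = l"
        then show "stn N (int (fst s) + int k) = m" using lk(1) by simp
      qed
      then show "of_bool (fst (rotate_state N k s) = m) * h (rotate_state N k s) = of_bool (fst s = l) * h s"
        unfolding inv[OF k s] by (simp only: rotate_state_def case_prod_beta fst_conv)
    qed auto
    finally show ?thesis ..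
  qed
  have int': "integrable (measure_pmf \<pi>) (\<lambda>s. of_bool (fst s = l) * h s)" for l
    by (rule Bochner_Integration.integrable_bound[OF int]) (auto intro!: AE_I2)
  have "E h = E (\<lambda>s. \<Sum>l=1..N. of_bool (fst s = l) * h s)"
    unfolding E_def
  proof (intro integral_cong_AE AE_pmfI)
    fix s assume s: "s \<in> set_pmf \<pi>"
    have "(\<Sum>l=1..N. of_bool (fst s = l) * h s) = (\<Sum>l=1..N. h s * of_bool (l = fst s))"
      by (intro sum.cong refl) auto
    then show "h s = (\<Sum>l=1..N. of_bool (fst s = l) * h s)"
      using sum_station_indicator[OF support(1)[OF s], of "\<lambda>_. h s"] by (simp only:)
  qed auto
  also have "\<dots> = (\<Sum>l=1..N. E (\<lambda>s. of_bool (fst s = l) * h s))"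
    unfolding E_def by (rule Bochner_Integration.integral_sum) (rule int')
  also have "\<dots> = real N * E (\<lambda>s. of_bool (fst s = m) * h s)"
    using eq by simp
  finally show ?thesis using N by simp
qed

lemma found_busy_rotate:
  assumes "s \<in> set_pmf \<pi>"
  shows "found_busy (rotate_state N k s) = found_busy s"
  using rotate_queue_at[OF N, of k "snd s" "int (fst s)"] stn_id[OF support(1)[OF assms]]
  by (simp add: found_busy_def rotate_state_def case_prod_beta)

lemma ahead_rotate: "ahead r (rotate_state N k s) = ahead r s"
proof -
  have "stn N (int (stn N (int (fst s) + int k)) + r) = stn N (int (fst s) + r + int k)"
    unfolding stn_add_left[OF N] by (simp add: add_ac)
  then show ?thesis
    unfolding ahead_def rotate_state_def case_prod_beta fst_conv snd_conv by (simp only: rotate_queue_at[OF N])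
qed

lemma E_queue:
  assumes m: "m \<in> {1..N}"
  shows "E (\<lambda>s. real (snd s m)) = ((\<Sum>d=1..N. u (int d)) + (\<Sum>d=1..N. y (int d))) / real N"
proof -
  have eq: "E (\<lambda>s. real (snd s l)) = E (\<lambda>s. real (snd s m))" if l: "l \<in> {1..N}" for l
  proof -
    define k where "k = stn N (int m - int l)"
    have k: "k \<in> {1..N}" unfolding k_def by (rule stn_in[OF N])
    have "stn N (int l + int k) = m"
      unfolding k_def stn_add_right[OF N] by (simp add: stn_id[OF m])
    then have "snd (rotate_state N k s) m = snd s l" for s
      using rotate_queue_at[OF N, of k "snd s" "int l"] stn_id[OF l] by (simp add: rotate_state_def case_prod_beta)
    then show ?thesis
      using E_rotate[OF k, of "\<lambda>s. real (snd s m)"] by simp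
  qed
  have "(\<Sum>d=1..N. u (int d)) + (\<Sum>d=1..N. y (int d)) = E total"
    unfolding sum_u sum_y unfolding E_def using integrable
    by (subst Bochner_Integration.integral_add[symmetric]) (auto simp: left_diff_distrib)
  also have "\<dots> = (\<Sum>l=1..N. E (\<lambda>s. real (snd s l)))"
    unfolding E_def total_def[abs_def] by (rule Bochner_Integration.integral_sum) (rule integrable_queue)
  also have "\<dots> = real N * E (\<lambda>s. real (snd s m))"
    using eq by simp
  finally show ?thesis using N by simp
qed

lemma prob_station:
  assumes "m \<in> {1..N}"
  shows "measure_pmf.prob \<pi> {s. fst s = m} = 1 / real N"
proof -
  have "measure_pmf.prob \<pi> {s. fst s = m} = E (indicator {s. fst s = m})"
    by (simp add: E_def)
  also have "\<dots> = E (\<lambda>s. of_bool (fst s = m) * 1)"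
    unfolding E_def by (intro Bochner_Integration.integral_cong) (auto simp: indicator_def)
  also have "\<dots> = 1 / real N"
    using E_at_station[OF assms, of "\<lambda>_. 1"] by (simp add: E_const)
  finally show ?thesis .
qed

lemma station_visited:
  assumes m: "m \<in> {1..N}"
  shows "set_pmf \<pi> \<inter> {s. fst s = m} \<noteq> {}"
proof -
  have "measure_pmf.prob \<pi> {s. fst s = m} \<noteq> 0"
    using prob_station[OF m] N by simp
  then show ?thesis
    by (auto simp: measure_pmf_zero_iff)
qed

lemma expectation_at_station:
  assumes m: "m \<in> {1..N}"
    and inv: "\<And>k s. k \<in> {1..N} \<Longrightarrow> s \<in> set_pmf \<pi> \<Longrightarrow> h (rotate_state N k s) = h s"
    and int: "integrable (measure_pmf \<pi>) h"
  shows "measure_pmf.expectation (at_station \<pi> m) h = E h"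
proof -
  have set: "{(i, x). i = m} = {s::state. fst s = m}" by auto
  show ?thesis
    unfolding at_station_def set expectation_cond_pmf[OF station_visited[OF m]] prob_station[OF m]
    using E_at_station[OF m inv int] N by (simp add: E_def)
qed

lemma set_at_station:
  assumes m: "m \<in> {1..N}" and s: "s \<in> set_pmf (at_station \<pi> m)"
  shows "fst s = m" "s \<in> set_pmf \<pi>"
proof -
  have set: "{(i, x). i = m} = {s::state. fst s = m}" by auto
  show "fst s = m" "s \<in> set_pmf \<pi>"
    using s unfolding at_station_def set set_cond_pmf[OF station_visited[OF m]] by auto
qed

lemma prob_busy_at_station:
  assumes m: "m \<in> {1..N}"
  shows "measure_pmf.prob (at_station \<pi> m) {(i, x). 0 < x m} = b"
proof -
  have "measure_pmf.prob (at_station \<pi> m) {(i, x). 0 < x m} =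
      measure_pmf.expectation (at_station \<pi> m) (indicator {(i, x). 0 < x m})"
    by simp
  also have "\<dots> = measure_pmf.expectation (at_station \<pi> m) found_busy"
    by (intro integral_cong_AE AE_pmfI) (auto simp: found_busy_def indicator_def dest: set_at_station(1)[OF m])
  also have "\<dots> = b"
    unfolding b_def by (rule expectation_at_station[OF m found_busy_rotate integrable_found_busy])
  finally show ?thesis .
qed

lemma prob_empty_at_station:
  assumes m: "m \<in> {1..N}"
  shows "measure_pmf.prob (at_station \<pi> m) {(i, x). x m = 0} = 1 - b"
proof -
  have "({(i, x). x m = 0} :: state set) = - {(i, x). 0 < x m}" by auto
  then show ?thesis
    using measure_pmf.prob_compl[of "{(i, x). 0 < x m}" "at_station \<pi> m"] prob_busy_at_station[OF m]
    by (simp add: Compl_eq_Diff_UNIV)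
qed

lemma expectation_queue_at_station:
  assumes m: "m \<in> {1..N}"
  shows "measure_pmf.expectation (at_station \<pi> m) (\<lambda>(i, x). real (x m)) = u 0"
proof -
  have "measure_pmf.expectation (at_station \<pi> m) (\<lambda>(i, x). real (x m)) =
      measure_pmf.expectation (at_station \<pi> m) (ahead 0)"
    by (intro integral_cong_AE AE_pmfI)
      (auto simp: ahead_def case_prod_beta stn_id[OF m] dest!: set_at_station(1)[OF m])
  also have "\<dots> = E (ahead 0)"
    by (rule expectation_at_station[OF m ahead_rotate integrable_ahead])
  also have "\<dots> = u 0"
    using u_plus_y[of 0] y_0 by simp
  finally show ?thesis .
qed

section \<open>Non-degeneracy\<close>

lemma E_positive:
  assumes "\<And>s. 0 \<le> f s" "integrable (measure_pmf \<pi>) f" "s \<in> state_space N" "0 < f s"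
  shows "0 < E f"
proof -
  have "s \<in> set_pmf \<pi>"
    using stationary_law_positive[OF irr stat assms(3)] by (simp add: set_pmf_iff)
  then have "\<not> (AE s in measure_pmf \<pi>. f s = 0)"
    using assms(4) by (auto simp: AE_measure_pmf_iff intro!: bexI[of _ s])
  then have "E f \<noteq> 0"
    unfolding E_def using integral_nonneg_eq_0_iff_AE[OF assms(2)] assms(1) by simp
  moreover have "0 \<le> E f"
    unfolding E_def using assms(1) by simp
  ultimately show ?thesis by simp
qed

lemma empty_state_in: "(1, \<lambda>_. 0) \<in> state_space N"
  using N by (simp add: state_space_def queue_space_def)

lemma single_customer_in: "(1, \<lambda>k. of_bool (k = 1)) \<in> state_space N"
  using N by (auto simp: state_space_def queue_space_def)

lemma b_pos: "0 < b"
  unfolding b_def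
  by (rule E_positive[OF _ integrable_found_busy single_customer_in]) (auto simp: found_busy_def)

lemma b_less_1: "b < 1"
proof -
  have "0 < E (\<lambda>s. 1 - found_busy s)"
    by (rule E_positive[OF _ _ empty_state_in]) (auto simp: found_busy_def[abs_def] integrable_found_busy[unfolded found_busy_def[abs_def]])
  also have "E (\<lambda>s. 1 - found_busy s) = 1 - b"
    unfolding E_def b_def using integrable_found_busy by simp
  finally show ?thesis by simp
qed

text \<open>Otherwise idle steps bring no arrivals, and the system would stay empty once it is empty, against
  irreducibility.\<close>

lemma idle_alpha_pos: "0 < idle.alpha"
proof (rule ccontr)
  have nonneg: "0 \<le> p' d * measure_pmf.expectation (idle.D d) (\<lambda>b. real (b k))" if "d \<in> {1..N}" for d k
    using idle.p_nonneg[OF that] by simp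
  assume "\<not> 0 < idle.alpha"
  moreover have "0 \<le> idle.alpha"
    unfolding idle.alpha_def by (intro sum_nonneg nonneg)
  ultimately have zero: "idle.alpha = 0" by simp
  have no_arrivals: "b = (\<lambda>_. 0)" if d: "d \<in> {1..N}" "0 < p' d" and b: "b \<in> set_pmf (idle.D d)" for d b
  proof
    fix k
    show "b k = 0"
    proof (cases "k \<in> {1..N}")
      case True
      have "\<forall>d\<in>{1..N}. p' d * measure_pmf.expectation (idle.D d) (\<lambda>b. real (b k)) = 0"
        by (rule iffD1[OF sum_nonneg_eq_0_iff[OF finite_atLeastAtMost nonneg]])
          (simp_all only: idle.alpha_at[OF True] zero)
      then have "measure_pmf.expectation (idle.D d) (\<lambda>b. real (b k)) = 0"
        using d by (metis less_irrefl mult_eq_0_iff)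
      then have "AE b in measure_pmf (idle.D d). real (b k) = 0"
        using integral_nonneg_eq_0_iff_AE[OF idle.integrable_D[OF d(1) True]] by simp
      then show ?thesis using b by (auto simp: AE_measure_pmf_iff)
    next
      case False
      then show ?thesis
        using idle.B_support[OF idle.N_in d(1)] b by (auto simp: queue_space_def)
    qed
  qed
  define C where "C = {1..N} \<times> {\<lambda>_::nat. 0::nat}"
  have closed: "set_pmf (K s) \<subseteq> C" if s: "s \<in> C" for s
  proof
    fix t assume t: "t \<in> set_pmf (K s)"
    obtain i where i: "i \<in> {1..N}" and s_eq: "s = (i, \<lambda>_. 0)"
      using s by (auto simp: C_def)
    obtain j b where j: "j \<in> set_pmf (route N P' i)" and b: "b \<in> set_pmf (B' i j)" and t_eq: "t = (j, b)"
      using t by (auto simp: s_eq polling_kernel_eq step_law_def)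
    have j_in: "j \<in> {1..N}" using idle.set_route[OF i] j by auto
    have "0 < p' (stn N (int j - int i))"
      using j idle.p_nonneg[OF stn_in[OF N], of "int j - int i"] j_in
      by (auto simp: set_pmf_iff idle.pmf_route[OF i] idle.P_eq[OF i j_in])
    then have "b = (\<lambda>_. 0)"
      using no_arrivals[OF stn_in[OF N]] b by (simp add: idle.B_eq_D[OF i j_in])
    then show "t \<in> C" using j_in by (simp add: C_def t_eq)
  qed
  have "(1, \<lambda>_. 0) \<in> C" using N by (simp add: C_def)
  from set_nstep_invariant[of C K, OF closed this]
  moreover have "(1, \<lambda>k. of_bool (k = 1)) \<notin> C"
    by (auto simp: C_def fun_eq_iff)
  ultimately have "pmf (nstep K n (1, \<lambda>_. 0)) (1, \<lambda>k. of_bool (k = 1)) = 0" for n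
    unfolding pmf_eq_0_set_pmf by blast
  then show False
    using irr empty_state_in single_customer_in unfolding irreducible_chain_def by (metis less_irrefl)
qed

text \<open>Rearranged, \<open>busy_probability\<close> says that \<open>b (1 - N \<alpha>) = (1 - b) N \<alpha>'\<close>.\<close>

lemma one_minus_N_alpha_pos: "0 < 1 - real N * busy.alpha"
proof -
  have "b * (1 - real N * busy.alpha) = real N * idle.alpha * (1 - b)"
    using busy_probability by (simp add: algebra_simps)
  moreover have "0 < real N * idle.alpha * (1 - b)"
    using N idle_alpha_pos b_less_1 by simp
  ultimately show ?thesis using b_pos by (metis zero_less_mult_pos)
qed

end

section \<open>Closed formulas for the mean queue lengths\<close>

context stationary_polling
begin

text \<open>The average, with weights \<open>b\<close> and \<open>1 - b\<close>, of the second derivatives of \<open>\<mu>\<^sub>N\<close> in the busy and the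
  idle regime, as a function of the distance of the two variables.\<close>

definition mixed :: "int \<Rightarrow> real" where
  "mixed e = b * (busy.corr e - of_bool (int N dvd e) * busy.alpha)
    + (1 - b) * (idle.corr e - of_bool (int N dvd e) * idle.alpha)"

lemma dvd_stn: "int N dvd int (stn N r) \<longleftrightarrow> int N dvd r"
  using stn_mod[OF N, of r] by (simp add: dvd_eq_mod_eq_0)

lemma cyclic_moments: "cyclic N u" "cyclic N y" "cyclic N (\<lambda>e. real N * mixed e)"
proof -
  show "cyclic N u" "cyclic N y"
    unfolding cyclic_def u_def y_def ahead_def stn_add_right[OF N] by simp_all
  have "mixed (int (stn N r)) = mixed r" for r
    unfolding mixed_def dvd_stn busy.corr_def idle.corr_def stn_add_right[OF N] ..
  then show "cyclic N (\<lambda>e. real N * mixed e)"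
    by (simp add: cyclic_def)
qed

lemma second_moments_mixed:
  "u e + u (- e) = (2 * busy.alpha * ((\<Sum>d=1..N. u (int d)) - b) + 2 * idle.alpha * (\<Sum>d=1..N. y (int d)))
    + real N * mixed e + (if int N dvd e then 2 * b else 0)"
proof -
  have "real N * (b * busy.corr e + (1 - b) * idle.corr e) =
      real N * mixed e + of_bool (int N dvd e) * (real N * (b * busy.alpha + (1 - b) * idle.alpha))"
    by (simp add: mixed_def algebra_simps)
  also have "\<dots> = real N * mixed e + of_bool (int N dvd e) * b"
    unfolding busy_probability[symmetric] ..
  finally show ?thesis
    unfolding second_moments_balance by simp
qed

lemma mean_while_idle:
  assumes ne: "\<And>k. 1 \<le> k \<Longrightarrow> k < N \<Longrightarrow> fourier N route_prob' k \<noteq> 1"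
    and eq: "(1\<^sub>m N - station_mat N P) * (1\<^sub>m N - transpose_mat (station_mat N P')) =
      (1\<^sub>m N - transpose_mat (station_mat N P)) * (1\<^sub>m N - station_mat N P')"
  shows "complex_of_real (\<Sum>d=1..N. y (int d)) =
    of_real b * (\<Sum>l=1..<N. 1 / (1 - fourier N route_prob' l)) +
    (\<Sum>l=1..<N. (1 - fourier N route_prob l) / (1 - fourier N route_prob' l) * (fourier N (\<lambda>e. real N * mixed e) l / 2))"
proof (rule cyclic_moment_system[OF N cyclic_route_prob cyclic_moments _ second_moments_mixed y_0 ne])
  fix r
  have "(\<Sum>d=1..N. p d * u (r + int d)) = (\<Sum>d=1..N. route_prob (int d) * u (r + int d))"
    "(\<Sum>d=1..N. p' d * y (r + int d)) = (\<Sum>d=1..N. route_prob' (int d) * y (r + int d))"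
    by (intro sum.cong refl, simp add: route_prob_def route_prob'_def stn_id)+
  then show "u r + y r = (\<Sum>d=1..N. route_prob (int d) * u (r + int d)) + (\<Sum>d=1..N. route_prob' (int d) * y (r + int d))
      - b * route_prob (- r) + (b * busy.alpha + (1 - b) * idle.alpha)"
    unfolding first_moments by (simp add: route_prob_def)
qed (auto intro: routing_eigenvalues_commute[OF eq])

text \<open>The second moment equations at frequency 0.\<close>

lemma sum_u_equation:
  "2 * (\<Sum>d=1..N. u (int d)) =
    real N * (2 * busy.alpha * ((\<Sum>d=1..N. u (int d)) - b) + 2 * idle.alpha * (\<Sum>d=1..N. y (int d)))
    + real N * (\<Sum>d=1..N. mixed (int d)) + 2 * b"
proof -
  have "(\<Sum>d=1..N. u (- int d)) = (\<Sum>d=1..N. u (int d))"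
    using sum_cyclic_uminus[OF N cyclic_moments(1), of 0] by simp
  then have "2 * (\<Sum>d=1..N. u (int d)) = (\<Sum>d=1..N. u (int d) + u (- int d))"
    by (simp add: sum.distrib)
  also have "\<dots> = (\<Sum>d=1..N. 2 * busy.alpha * ((\<Sum>d=1..N. u (int d)) - b) + 2 * idle.alpha * (\<Sum>d=1..N. y (int d)))
      + (\<Sum>d=1..N. real N * mixed (int d)) + (\<Sum>d=1..N. if int N dvd int d then 2 * b else 0)"
    unfolding second_moments_mixed sum.distrib ..
  also have "(\<Sum>d=1..N. if int N dvd int d then 2 * b else 0) = (\<Sum>d=1..N. if d = N then 2 * b else 0)"
    by (intro sum.cong) (auto dest: dvd_imp_le)
  also have "\<dots> = 2 * b"
    using N by simp
  finally show ?thesis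
    by (simp add: sum_distrib_left)
qed

lemma mean_formulas:
  assumes ne: "\<And>k. 1 \<le> k \<Longrightarrow> k < N \<Longrightarrow> fourier N route_prob' k \<noteq> 1"
    and eq: "(1\<^sub>m N - station_mat N P) * (1\<^sub>m N - transpose_mat (station_mat N P')) =
      (1\<^sub>m N - transpose_mat (station_mat N P)) * (1\<^sub>m N - station_mat N P')"
  defines "n \<equiv> complex_of_nat N" and "A \<equiv> complex_of_real busy.alpha" and "A' \<equiv> complex_of_real idle.alpha"
    and "c \<equiv> \<lambda>d. complex_of_real (mixed (int d))"
    and "\<beta> \<equiv> complex_of_real b * complex_of_real busy.alpha + (1 - complex_of_real b) * complex_of_real idle.alpha"
  defines "T \<equiv> \<Sum>l=1..<N. 1 / (1 - fourier N route_prob' l)"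
    and "Z \<equiv> \<Sum>l=1..<N. (fourier N route_prob l - fourier N route_prob' l) / (1 - fourier N route_prob' l) * (1 / 2) * (\<Sum>d=1..N. c d * omega N l ^ d)"
  shows "1 - complex_of_real b = (1 - n * A) / (1 - n * A + n * A')"
    and "complex_of_real (u 0) = n * \<beta> + n * A' * \<beta> / (1 - n * A) * T
      + (1 - n * A + n * A') / (1 - n * A) * (n / 2) * c N
      + (n * A - n * A') / (1 - n * A) * (1 / 2) * (\<Sum>d=1..N. c d)
      - n * A' / (1 - n * A) * Z"
    and "complex_of_real (((\<Sum>d=1..N. u (int d)) + (\<Sum>d=1..N. y (int d))) / real N) = \<beta> + A' / (1 - n * A) * T
      + (1 - n * A + n * A') / (1 - n * A) * (n / 2) * c N
      + (n * A - n * A') / (1 - n * A) * (1 / 2) * (\<Sum>d=1..N. c d)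
      - (1 - n * A + n * A') / (1 - n * A) * Z"
proof -
  define U where "U = complex_of_real (\<Sum>d=1..N. u (int d))"
  define Y where "Y = complex_of_real (\<Sum>d=1..N. y (int d))"
  define G where "G = (\<Sum>d=1..N. c d)"
  define F where "F l = (\<Sum>d=1..N. c d * omega N l ^ d)" for l
  have F: "fourier N (\<lambda>e. real N * mixed e) l = n * F l" for l
    by (simp add: fourier_def F_def c_def n_def omega_power sum_distrib_left mult_ac)
  have n0: "n \<noteq> 0" using N by (simp add: n_def)
  have F_sum: "(\<Sum>l=1..<N. F l) = n * c N - G"
  proof -
    have "(\<Sum>l=1..N. n * F l) = n * (n * c N)"
      using sum_fourier[OF N cyclic_moments(3)] cyclic_0[OF N cyclic_moments(3)] N
      by (simp add: F c_def n_def)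
    then have "(\<Sum>l=1..N. F l) = n * c N"
      using n0 by (simp flip: sum_distrib_left)
    moreover have "(\<Sum>l=1..N. F l) = F N + (\<Sum>l=1..<N. F l)"
      using N by (simp add: sum.last_plus)
    moreover have "F N = G"
      using N by (simp add: F_def G_def omega_power character_full)
    ultimately show ?thesis by (simp add: algebra_simps)
  qed
  have Y: "Y = complex_of_real b * T + n * ((n * c N - G) / 2 - Z)"
  proof -
    \<comment> \<open>The factor \<open>(1 - \<mu>) / (1 - \<mu>')\<close> is rewritten as \<open>1 - (\<mu> - \<mu>') / (1 - \<mu>')\<close>; the part coming from 1 is summed by Fourier inversion.\<close>
    have "(1 - fourier N route_prob l) / (1 - fourier N route_prob' l) * (n * F l / 2) =
        n * (F l / 2 - (fourier N route_prob l - fourier N route_prob' l) / (1 - fourier N route_prob' l) * (1 / 2) * F l)"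
      if "l \<in> {1..<N}" for l
    proof -
      have nz: "1 - fourier N route_prob' l \<noteq> 0"
        using ne[of l] that by simp
      have "(1 - fourier N route_prob l) / (1 - fourier N route_prob' l) =
          1 - (fourier N route_prob l - fourier N route_prob' l) / (1 - fourier N route_prob' l)"
        using nz by (simp add: field_simps)
      moreover have "(1 - x) * (n * f / 2) = n * (f / 2 - x * (1 / 2) * f)" for x f
        by (simp add: algebra_simps diff_divide_distrib)
      ultimately show ?thesis by (simp only:)
    qed
    then have "(\<Sum>l=1..<N. (1 - fourier N route_prob l) / (1 - fourier N route_prob' l) * (n * F l / 2)) =
        n * ((\<Sum>l=1..<N. F l) / 2 - Z)"
      unfolding Z_def F_def[symmetric] sum_divide_distrib sum_subtractf[symmetric] sum_distrib_left
      by (intro sum.cong refl) simp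
    then show ?thesis
      using mean_while_idle[OF ne eq] by (simp only: Y_def T_def F F_sum)
  qed
  have U: "2 * U = n * (2 * A * (U - complex_of_real b) + 2 * A' * Y) + n * G + 2 * complex_of_real b"
    using arg_cong[OF sum_u_equation, of complex_of_real]
    by (simp add: U_def Y_def G_def n_def A_def A'_def c_def)
  have u0: "2 * complex_of_real (u 0) = 2 * A * (U - complex_of_real b) + 2 * A' * Y + n * c N + 2 * complex_of_real b"
    using arg_cong[OF second_moments_mixed[of 0], of complex_of_real] cyclic_0[OF N cyclic_moments(3)] N
    by (simp add: U_def Y_def n_def A_def A'_def c_def)
  have \<beta>: "complex_of_real b = n * \<beta>"
    using arg_cong[OF busy_probability, of complex_of_real] by (simp add: n_def \<beta>_def)
  have D: "1 - n * A \<noteq> 0"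
  proof -
    have "1 - n * A = complex_of_real (1 - real N * busy.alpha)"
      by (simp add: n_def A_def)
    then show ?thesis using one_minus_N_alpha_pos by (simp only: of_real_eq_0_iff)
  qed
  have D': "1 - n * A + n * A' \<noteq> 0"
  proof -
    have "1 - n * A + n * A' = complex_of_real (1 - real N * busy.alpha + real N * idle.alpha)"
      by (simp add: n_def A_def A'_def)
    moreover have "0 < 1 - real N * busy.alpha + real N * idle.alpha"
      using one_minus_N_alpha_pos idle_alpha_pos N by (intro add_pos_nonneg) auto
    ultimately show ?thesis by (simp only: of_real_eq_0_iff)
  qed
  note closed = closed_form_of_means[OF n0 D D' _ \<beta> Y U u0, folded A_def A'_def]
  show "1 - complex_of_real b = (1 - n * A) / (1 - n * A + n * A')"
    by (rule closed(1)) (simp add: \<beta>_def A_def A'_def)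
  show "complex_of_real (u 0) = n * \<beta> + n * A' * \<beta> / (1 - n * A) * T
      + (1 - n * A + n * A') / (1 - n * A) * (n / 2) * c N
      + (n * A - n * A') / (1 - n * A) * (1 / 2) * (\<Sum>d=1..N. c d)
      - n * A' / (1 - n * A) * Z"
    unfolding G_def[symmetric] by (rule closed(2)) (simp add: \<beta>_def A_def A'_def)
  have "complex_of_real (((\<Sum>d=1..N. u (int d)) + (\<Sum>d=1..N. y (int d))) / real N) = (U + Y) / n"
    by (simp add: U_def Y_def n_def)
  also have "\<dots> = \<beta> + A' / (1 - n * A) * T
      + (1 - n * A + n * A') / (1 - n * A) * (n / 2) * c N
      + (n * A - n * A') / (1 - n * A) * (1 / 2) * G
      - (1 - n * A + n * A') / (1 - n * A) * Z"
    by (rule closed(3)) (simp add: \<beta>_def A_def A'_def)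
  finally show "complex_of_real (((\<Sum>d=1..N. u (int d)) + (\<Sum>d=1..N. y (int d))) / real N) = \<beta> + A' / (1 - n * A) * T
      + (1 - n * A + n * A') / (1 - n * A) * (n / 2) * c N
      + (n * A - n * A') / (1 - n * A) * (1 / 2) * (\<Sum>d=1..N. c d)
      - (1 - n * A + n * A') / (1 - n * A) * Z"
    unfolding G_def .
qed

end

theorem theorem5p2:
  fixes N :: nat
    and P P' :: "nat \<Rightarrow> nat \<Rightarrow> real"
    and B B' :: "nat \<Rightarrow> nat \<Rightarrow> (nat \<Rightarrow> nat) pmf"
    and p p' :: "nat \<Rightarrow> real"
    and a a' :: "nat \<Rightarrow> (nat \<Rightarrow> real) \<Rightarrow> real"
    and \<pi> :: "state pmf"
    and m r q :: nat
  defines "K \<equiv> polling_kernel N P P' B B'"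
    and "n \<equiv> complex_of_nat N"
    and "\<omega> \<equiv> omega N"
    and "\<mu> \<equiv> (\<lambda>k. mu N p a k ones)"
    and "\<mu>' \<equiv> (\<lambda>k. mu N p' a' k ones)"
    and "\<alpha> \<equiv> alpha1 N p a r"
    and "\<alpha>' \<equiv> alpha1 N p' a' r"
    and "busy \<equiv> complex_of_real (measure_pmf.prob (at_station \<pi> m) {(i, x). x m > 0})"
    and "empt \<equiv> complex_of_real (measure_pmf.prob (at_station \<pi> m) {(i, x). x m = 0})"
  defines "\<alpha>b \<equiv> busy * \<alpha> + empt * \<alpha>'"
    and "\<alpha>b2 \<equiv> (\<lambda>d. busy * alpha2 N p a q d + empt * alpha2 N p' a' q d)"
  assumes "1 \<le> N"
    and "stochastic N P" and "stochastic N P'"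
    and "arrival_laws N B" and "arrival_laws N B'"
    and "irreducible_chain (state_space N) K"
    and "ergodic_chain (state_space N) K"
    and "stationary_law (state_space N) K \<pi>"
    and "\<And>k. k \<in> {1..N} \<Longrightarrow> integrable (measure_pmf \<pi>) (\<lambda>(i, x). (real (x k))\<^sup>2)"
    and "rot_symmetric N P B p a" and "rot_symmetric N P' B' p' a'"
    and "\<And>k. 1 \<le> k \<Longrightarrow> k < N \<Longrightarrow> \<mu>' k \<noteq> 1"
    and "(1\<^sub>m N - station_mat N P) * (1\<^sub>m N - transpose_mat (station_mat N P')) =
         (1\<^sub>m N - transpose_mat (station_mat N P)) * (1\<^sub>m N - station_mat N P')"
    and "m \<in> {1..N}" and "r \<in> {1..N}" and "q \<in> {1..N}"
  shows "empt = (1 - n * \<alpha>) / (1 - n * \<alpha> + n * \<alpha>')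
    \<and> complex_of_real (measure_pmf.expectation (at_station \<pi> m) (\<lambda>(i, x). real (x m))) =
        n * \<alpha>b
        + n * \<alpha>' * \<alpha>b / (1 - n * \<alpha>) * (\<Sum>l=1..<N. 1 / (1 - \<mu>' l))
        + (1 - n * \<alpha> + n * \<alpha>') / (1 - n * \<alpha>) * (n / 2) * \<alpha>b2 N
        + (n * \<alpha> - n * \<alpha>') / (1 - n * \<alpha>) * (1 / 2) * (\<Sum>d=1..N. \<alpha>b2 d)
        - n * \<alpha>' / (1 - n * \<alpha>) *
            (\<Sum>l=1..<N. (\<mu> l - \<mu>' l) / (1 - \<mu>' l) * (1 / 2) * (\<Sum>d=1..N. \<alpha>b2 d * \<omega> l ^ d))
    \<and> complex_of_real (measure_pmf.expectation \<pi> (\<lambda>(i, x). real (x m))) =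
        \<alpha>b
        + \<alpha>' / (1 - n * \<alpha>) * (\<Sum>l=1..<N. 1 / (1 - \<mu>' l))
        + (1 - n * \<alpha> + n * \<alpha>') / (1 - n * \<alpha>) * (n / 2) * \<alpha>b2 N
        + (n * \<alpha> - n * \<alpha>') / (1 - n * \<alpha>) * (1 / 2) * (\<Sum>d=1..N. \<alpha>b2 d)
        - (1 - n * \<alpha> + n * \<alpha>') / (1 - n * \<alpha>) *
            (\<Sum>l=1..<N. (\<mu> l - \<mu>' l) / (1 - \<mu>' l) * (1 / 2) * (\<Sum>d=1..N. \<alpha>b2 d * \<omega> l ^ d))"
proof -
  interpret stationary_polling N P B p a P' B' p' a' \<pi>
    by unfold_locales (use assms in \<open>simp_all add: K_def\<close>)
  have m: "m \<in> {1..N}" and r: "r \<in> {1..N}" and q: "q \<in> {1..N}" by fact+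
  have busy_eq: "busy = of_real b"
    unfolding busy_def prob_busy_at_station[OF m] ..
  have empt_eq: "empt = 1 - of_real b"
    unfolding empt_def prob_empty_at_station[OF m] by simp
  have \<alpha>_eq: "\<alpha> = of_real busy.alpha" "\<alpha>' = of_real idle.alpha"
    unfolding \<alpha>_def \<alpha>'_def by (rule busy.alpha1_eq[OF r], rule idle.alpha1_eq[OF r])
  have \<mu>_eq: "\<mu> = fourier N route_prob" "\<mu>' = fourier N route_prob'"
    unfolding \<mu>_def \<mu>'_def busy.mu_ones idle.mu_ones route_prob_def[abs_def] route_prob'_def[abs_def] by (rule refl)+
  have \<alpha>b_eq: "\<alpha>b = of_real b * of_real busy.alpha + (1 - of_real b) * of_real idle.alpha"
    unfolding \<alpha>b_def busy_eq empt_eq \<alpha>_eq ..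
  have \<alpha>b2_eq: "\<alpha>b2 = (\<lambda>d. of_real (mixed (int d)))"
    unfolding \<alpha>b2_def busy_eq empt_eq busy.alpha2_eq[OF q] idle.alpha2_eq[OF q] mixed_def by simp
  have mean_eq: "measure_pmf.expectation \<pi> (\<lambda>(i, x). real (x m)) =
      ((\<Sum>d=1..N. u (int d)) + (\<Sum>d=1..N. y (int d))) / real N"
    using E_queue[OF m] by (simp add: E_def case_prod_unfold)
  have ne: "fourier N route_prob' k \<noteq> 1" if "1 \<le> k" "k < N" for k
    using assms that by (simp add: \<mu>_eq[symmetric])
  have comm: "(1\<^sub>m N - station_mat N P) * (1\<^sub>m N - transpose_mat (station_mat N P')) =
      (1\<^sub>m N - transpose_mat (station_mat N P)) * (1\<^sub>m N - station_mat N P')"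
    by fact
  show ?thesis
    unfolding empt_eq expectation_queue_at_station[OF m] mean_eq
    unfolding \<alpha>_eq \<mu>_eq \<alpha>b_eq \<alpha>b2_eq n_def \<omega>_def
    by (intro conjI mean_formulas[OF ne comm])
qed

end
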